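(* Suppose $|\mathbb F|=q<\infty$, $r\geq1$, and that $r=m=n$ does not hold. Then $$\operatorname{rank}(\mathcal E_{mn}^J)=\operatorname{idrank}(\mathcal E_{mn}^J)=q^{r(L-r)}+\frac{q^r-1}{q-1},$$ where $L=\max(m,n)$.
   Context: Let $\mathbb F$ be a field, $m,n\geq1$ integers, and $r\leq\min(m,n)$. $\mathcal M_{kl}$ denotes the set of all $k\times l$ matrices over $\mathbb F$. Let $J=\begin{bmatrix}I_r&O\\O&O\end{bmatrix}\in\mathcal M_{nm}$ (an $n\times m$ matrix), and let $\mathcal M_{mn}^J$ be the semigroup with underlying set $\mathcal M_{mn}$ and operation $X\star Y=XJY$. $\mathcal E_{mn}^J$ is the subsemigroup of $\mathcal M_{mn}^J$ generated by all of its idempotents (the $X\in\mathcal M_{mn}$ with $X=X\star X$). For a semigroup $S$, $\operatorname{rank}(S)$ is the minimum size of a generating set for $S$ (as a semigroup); for an idempotent generated semigroup $S$, $\operatorname{idrank}(S)$ is the minimum size of a generating set for $S$ consisting of idempotents. *)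

theory Defs
  imports "Jordan_Normal_Form.Matrix" "HOL-Library.Extended_Nat"
begin

text \<open>A semigroup is given by a carrier set \<open>S\<close> and an operation \<open>f\<close>.\<close>

inductive_set subsemigroup_gen :: "('b \<Rightarrow> 'b \<Rightarrow> 'b) \<Rightarrow> 'b set \<Rightarrow> 'b set"
  for f :: "'b \<Rightarrow> 'b \<Rightarrow> 'b" and A :: "'b set" where
  gen: "x \<in> A \<Longrightarrow> x \<in> subsemigroup_gen f A"
| mult: "\<lbrakk>x \<in> subsemigroup_gen f A; y \<in> subsemigroup_gen f A\<rbrakk> \<Longrightarrow> f x y \<in> subsemigroup_gen f A"

definition idempotents :: "('b \<Rightarrow> 'b \<Rightarrow> 'b) \<Rightarrow> 'b set \<Rightarrow> 'b set" where
  "idempotents f S = {x \<in> S. x = f x x}"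

text \<open>
  The minimum is taken over finite generating sets, in \<^typ>\<open>enat\<close>; since \<open>Inf {} = \<infinity>\<close>, both numbers
  are \<open>\<infinity>\<close> when no finite generating set of the required kind exists.
\<close>

definition semigroup_rank :: "('b \<Rightarrow> 'b \<Rightarrow> 'b) \<Rightarrow> 'b set \<Rightarrow> enat" where
  "semigroup_rank f S =
     Inf {enat (card A) | A. finite A \<and> A \<subseteq> S \<and> subsemigroup_gen f A = S}"

definition semigroup_idrank :: "('b \<Rightarrow> 'b \<Rightarrow> 'b) \<Rightarrow> 'b set \<Rightarrow> enat" where
  "semigroup_idrank f S =
     Inf {enat (card A) | A. finite A \<and> A \<subseteq> idempotents f S \<and> subsemigroup_gen f A = S}"

definition J_mat :: "nat \<Rightarrow> nat \<Rightarrow> nat \<Rightarrow> 'a::field mat" where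
  "J_mat n m r =
     four_block_mat (1\<^sub>m r)           (0\<^sub>m r (m - r))
                    (0\<^sub>m (n - r) r)   (0\<^sub>m (n - r) (m - r))"

definition sandwich :: "'a::field mat \<Rightarrow> 'a mat \<Rightarrow> 'a mat \<Rightarrow> 'a mat" where
  "sandwich J X Y = X * J * Y"

definition E_semigroup :: "nat \<Rightarrow> nat \<Rightarrow> nat \<Rightarrow> 'a::field mat set" where
  "E_semigroup m n r =
     subsemigroup_gen (sandwich (J_mat n m r))
       (idempotents (sandwich (J_mat n m r)) (carrier_mat m n))"

end

theory Submission
  imports Defs "Jordan_Normal_Form.Determinant"
begin

text \<open>
  Let \<open>\<iota>\<^sub>k\<close> be the \<open>k \<times> r\<close> matrix with \<open>I\<^sub>r\<close> on top and \<open>\<pi>\<^sub>k\<close> its transpose, so that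
  \<open>J = \<iota>\<^sub>n \<pi>\<^sub>m\<close>. The elements of the semigroup are the products \<open>P A Q\<close> with \<open>\<pi>\<^sub>m P = I\<close>, \<open>Q \<iota>\<^sub>n = I\<close>
  and \<open>A\<close> either \<open>I\<^sub>r\<close> or singular, and \<open>(P A Q) \<star> (P' A' Q') = P A A' Q'\<close>. Those with \<open>A = I\<^sub>r\<close> form a
  rectangular band whose complement is an ideal; a generating set has to meet each of its rows and
  columns, and meeting them is enough to generate the band. Likewise, for each line some generator
  must have an \<open>A\<close> with this line as left kernel. This gives the lower bound.

  For the upper bound, one idempotent \<open>I - u v\<^sup>T\<close> per line of \<open>F\<^sup>r\<close> has to generate all singular
  matrices. Match the lines bijectively with hyperplanes not containing them. Since fewer than half
  of the lines lie in a given hyperplane, any prescribed kernel and image can be joined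
  by a product of three of the matched idempotents, and a power of this product is the
  idempotent with that kernel and image. Finally, all singular matrices are products of idempotents
  \<open>I - u v\<^sup>T\<close>.
\<close>

subsection \<open>Matching lines with hyperplanes\<close>

text \<open>
  The matching sends the line of \<open>(0, \<dots>, 0, 1, a)\<close> to the hyperplane orthogonal to
  \<open>(0, \<dots>, 0, 1, twist a)\<close>. It misses the line because \<open>a \<bullet> twist a\<close> never equals \<open>- 1\<close>: pairs of
  coordinates contribute \<open>0\<close>, and a remaining last coordinate contributes \<open>a - 1\<close> if \<open>a \<noteq> 0\<close> and \<open>0\<close>
  otherwise (here \<open>inverse 0 = 0\<close> matters).
\<close>

fun twist :: "'a::field list \<Rightarrow> 'a list" where
  "twist [] = []"
| "twist [a] = [1 - inverse a]"
| "twist (a # b # xs) = b # - a # twist xs"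

fun normalized :: "'a::field list \<Rightarrow> bool" where
  "normalized [] = False"
| "normalized (x # xs) = (if x = 0 then normalized xs else x = 1)"

fun dual_list :: "'a::field list \<Rightarrow> 'a list" where
  "dual_list [] = []"
| "dual_list (x # xs) = (if x = 0 then 0 # dual_list xs else x # twist xs)"

lemma length_twist [simp]: "length (twist xs) = length xs"
  by (induction xs rule: twist.induct) auto

lemma twist_inject [simp]: "twist xs = twist ys \<longleftrightarrow> xs = ys"
proof
  assume eq: "twist xs = twist ys"
  then have "length xs = length ys"
    by (metis length_twist)
  then show "xs = ys"
    using eq
  proof (induction xs arbitrary: ys rule: twist.induct)
    case (2 a)
    then obtain b where "ys = [b]"
      by (cases ys) auto
    with 2 show ?case by simp
  next
    case (3 a b xs)
    then obtain c d zs where "ys = c # d # zs"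
      by (metis length_Suc_conv)
    with 3 show ?case by simp
  qed auto
qed simp

lemma twist_scalar_prod: "vec_of_list (twist xs) \<bullet> vec_of_list xs \<noteq> (- 1 :: 'a::field)"
proof (induction xs rule: twist.induct)
  case (2 a)
  then show ?case by (cases "a = 0") (simp_all add: left_diff_distrib)
qed (simp_all add: algebra_simps)

lemma length_dual_list [simp]: "length (dual_list xs) = length xs"
  by (induction xs) auto

lemma normalized_dual_list: "normalized xs \<Longrightarrow> normalized (dual_list xs)"
  by (induction xs) (auto split: if_splits)

lemma dual_list_inject:
  "length xs = length ys \<Longrightarrow> dual_list xs = dual_list ys \<Longrightarrow> xs = ys"
  by (induction xs ys rule: list_induct2) (auto split: if_splits)

lemma dual_list_scalar_prod:
  "normalized xs \<Longrightarrow> vec_of_list (dual_list xs) \<bullet> vec_of_list xs \<noteq> (0 :: 'a::field)"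
proof (induction xs)
  case (Cons x xs)
  then show ?case
    using twist_scalar_prod[of xs] by (auto simp: add_eq_0_iff split: if_splits)
qed simp

text \<open>Vectors with first nonzero entry \<open>1\<close> represent the lines.\<close>

definition points :: "nat \<Rightarrow> 'a::field vec set" where
  "points r = vec_of_list ` {xs. length xs = r \<and> normalized xs}"

definition dual :: "'a::field vec \<Rightarrow> 'a vec" where
  "dual v = vec_of_list (dual_list (list_of_vec v))"

lemma smult_vCons [simp]: "c \<cdot>\<^sub>v vCons a v = vCons (c * a) (c \<cdot>\<^sub>v v)"
  by (rule eq_vecI) (auto simp: vec_index_vCons)

lemma points_0: "points 0 = {}"
  by (auto simp: points_def)

text \<open>Sorting the points by their first entry, \<open>0\<close> or \<open>1\<close>, gives the
  recursion for the inductions on \<open>r\<close> below.\<close>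

lemma points_Suc: "points (Suc r) = vCons 0 ` points r \<union> vCons 1 ` carrier_vec r" (is "?L = ?R")
proof
  show "?L \<subseteq> ?R"
  proof
    fix v :: "'a vec"
    assume "v \<in> ?L"
    then obtain xs where xs: "length xs = Suc r" "normalized xs" "v = vec_of_list xs"
      by (auto simp: points_def)
    then obtain y ys where "xs = y # ys"
      by (cases xs) auto
    with xs have ys: "length ys = r" "if y = 0 then normalized ys else y = 1"
      "v = vCons y (vec_of_list ys)"
      by simp_all
    have "vec_of_list ys \<in> carrier_vec (length ys)"
      by (rule carrier_vecI) simp
    with ys show "v \<in> ?R"
      by (cases "y = 0") (simp_all add: points_def)
  qed
  show "?R \<subseteq> ?L"
  proof
    fix v :: "'a vec"
    assume "v \<in> ?R"
    then consider xs where "length xs = r" "normalized xs" "v = vec_of_list (0 # xs)"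
      | w where "w \<in> carrier_vec r" "v = vCons 1 w"
      by (auto simp: points_def)
    then show "v \<in> ?L"
    proof cases
      case 1
      then have "0 # xs \<in> {xs. length xs = Suc r \<and> normalized xs}" by simp
      with 1 show ?thesis unfolding points_def by blast
    next
      case 2
      then have "1 # list_of_vec w \<in> {xs. length xs = Suc r \<and> normalized xs}" by simp
      moreover have "v = vec_of_list (1 # list_of_vec w)"
        using 2 by (simp add: vec_list)
      ultimately show ?thesis unfolding points_def by blast
    qed
  qed
qed

lemma points_carrier: "x \<in> points r \<Longrightarrow> x \<in> carrier_vec r"
  unfolding points_def by (auto intro: carrier_vecI)

lemma dual_points: "x \<in> points r \<Longrightarrow> dual x \<in> points r"
  by (auto simp: points_def dual_def list_vec normalized_dual_list)

lemma dual_nonorthogonal: "x \<in> points r \<Longrightarrow> dual x \<bullet> x \<noteq> 0"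
  by (auto simp: points_def dual_def list_vec dest: dual_list_scalar_prod)

lemma inj_on_dual: "inj_on dual (points r)"
proof (rule inj_onI)
  fix x y :: "'a vec"
  assume "x \<in> points r" "y \<in> points r" and eq: "dual x = dual y"
  then obtain xs ys where "x = vec_of_list xs" "y = vec_of_list ys" "length xs = length ys"
    by (auto simp: points_def)
  with eq show "x = y"
    by (metis dual_def dual_list_inject list_vec)
qed

lemma points_nonzero: "x \<in> points r \<Longrightarrow> x \<noteq> 0\<^sub>v r"
  using dual_nonorthogonal[of x r] points_carrier[OF dual_points[of x r]] by auto

lemma ex_point_multiple:
  "v \<in> carrier_vec r \<Longrightarrow> v \<noteq> 0\<^sub>v r \<Longrightarrow> \<exists>x\<in>points r. \<exists>c. c \<noteq> 0 \<and> v = c \<cdot>\<^sub>v x"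
proof (induction r arbitrary: v)
  case 0
  then show ?case by auto
next
  case (Suc r)
  then obtain a w where v: "v = vCons a w" "w \<in> carrier_vec r"
    by (cases v) auto
  show ?case
  proof (cases "a = 0")
    case True
    with Suc.prems v have "w \<noteq> 0\<^sub>v r"
      by (auto simp: zero_vec_Suc)
    with Suc.IH v obtain x c where x: "x \<in> points r" "c \<noteq> 0" "w = c \<cdot>\<^sub>v x"
      by blast
    then have "vCons 0 x \<in> points (Suc r)" and "v = c \<cdot>\<^sub>v vCons 0 x"
      using True v by (auto simp: points_Suc)
    with x show ?thesis by blast
  next
    case False
    then have "v = a \<cdot>\<^sub>v vCons 1 (inverse a \<cdot>\<^sub>v w)"
      using v by (simp add: smult_smult_assoc)
    moreover have "vCons 1 (inverse a \<cdot>\<^sub>v w) \<in> points (Suc r)"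
      using v by (auto simp: points_Suc)
    ultimately show ?thesis using False by blast
  qed
qed

text \<open>A nonzero factor cannot turn a first entry \<open>0\<close> into \<open>1\<close>. If
  both first entries are \<open>1\<close>, so is the factor; if both are \<open>0\<close>, the tails
  are compared.\<close>

lemma proportional_points_eq:
  "x \<in> points r \<Longrightarrow> y \<in> points r \<Longrightarrow> x = c \<cdot>\<^sub>v y \<Longrightarrow> x = y"
proof (induction r arbitrary: x y)
  case (Suc r)
  then have "c \<noteq> 0"
    using points_nonzero[OF Suc.prems(1)] points_carrier[OF Suc.prems(2)]
    by auto
  with Suc show ?case
    by (auto simp: points_Suc)
qed (simp add: points_0)

section \<open>Counting vectors and points over a finite field\<close>

lemma card_carrier_vec:
  assumes "finite (UNIV :: 'a set)"
  shows "finite (carrier_vec r :: 'a vec set)"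
    and "card (carrier_vec r :: 'a vec set) = card (UNIV :: 'a set) ^ r"
proof -
  have carrier: "vec_of_list xs \<in> carrier_vec (length xs)" for xs :: "'a list"
    by (rule carrier_vecI) simp
  have bij: "bij_betw vec_of_list {xs :: 'a list. set xs \<subseteq> UNIV \<and> length xs = r} (carrier_vec r)"
  proof (rule bij_betw_byWitness[where f' = list_of_vec])
    show "vec_of_list ` {xs :: 'a list. set xs \<subseteq> UNIV \<and> length xs = r} \<subseteq> carrier_vec r"
      using carrier by blast
  qed (auto simp: list_vec vec_list)
  show "finite (carrier_vec r :: 'a vec set)"
    using bij_betw_finite[OF bij] finite_lists_length_eq[OF assms, of r] by simp
  show "card (carrier_vec r :: 'a vec set) = card (UNIV :: 'a set) ^ r"
    using bij_betw_same_card[OF bij] card_lists_length_eq[OF assms, of r] by simp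
qed

lemma finite_points: "finite (UNIV :: 'a::field set) \<Longrightarrow> finite (points r :: 'a vec set)"
  by (meson card_carrier_vec(1) finite_subset points_carrier subsetI)

text \<open>An injective map of a finite set into itself is onto; so every hyperplane is orthogonal
  to the dual of some point.\<close>

lemma bij_betw_dual:
  assumes "finite (UNIV :: 'a::field set)"
  shows "bij_betw dual (points r) (points r :: 'a vec set)"
proof -
  have "dual ` points r \<subseteq> (points r :: 'a vec set)"
    using dual_points by blast
  then have "dual ` points r = (points r :: 'a vec set)"
    by (rule endo_inj_surj[OF finite_points[OF assms] _ inj_on_dual])
  then show ?thesis
    by (rule bij_betw_imageI[OF inj_on_dual])
qed

lemma card_points:
  assumes fin: "finite (UNIV :: 'a::field set)"
  shows "card (points r :: 'a vec set) = (card (UNIV :: 'a set) ^ r - 1) div (card (UNIV :: 'a set) - 1)"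
proof -
  define q where "q = card (UNIV :: 'a set)"
  have "card {0, 1 :: 'a} \<le> q"
    unfolding q_def by (rule card_mono[OF fin]) simp
  then have q: "q \<ge> 2" by simp
  \<comment> \<open>Clearing the denominator keeps \<open>div\<close> out of the induction, and
    adding \<open>1\<close> avoids a subtraction from \<open>q ^ r\<close>.\<close>
  have "card (points r :: 'a vec set) * (q - 1) + 1 = q ^ r" for r
  proof (induction r)
    case (Suc r)
    have "card (points (Suc r) :: 'a vec set) =
      card (vCons 0 ` points r :: 'a vec set) + card (vCons 1 ` carrier_vec r :: 'a vec set)"
      unfolding points_Suc
      by (rule card_Un_disjoint) (auto simp: finite_points[OF fin] card_carrier_vec[OF fin])
    also have "\<dots> = card (points r :: 'a vec set) + q ^ r"
      by (simp add: card_image inj_on_def card_carrier_vec[OF fin] q_def)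
    finally have "card (points (Suc r) :: 'a vec set) * (q - 1) + 1
      = card (points r :: 'a vec set) * (q - 1) + 1 + q ^ r * (q - 1)"
      by (simp add: algebra_simps)
    also have "\<dots> = q ^ Suc r"
      using Suc q by (simp add: diff_mult_distrib2)
    finally show ?case .
  qed (simp add: points_0)
  then have "q ^ r - 1 = card (points r :: 'a vec set) * (q - 1)"
    by (metis add_diff_cancel_right')
  with q show ?thesis
    unfolding q_def[symmetric] by simp
qed

subsection \<open>Singular matrices as products of idempotents\<close>

lemma mat_eqI_unit_vec:
  fixes A B :: "'a::semiring_1 mat"
  assumes "A \<in> carrier_mat m n" "B \<in> carrier_mat m n"
    and "\<And>l. l < n \<Longrightarrow> A *\<^sub>v unit_vec n l = B *\<^sub>v unit_vec n l"
  shows "A = B"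
proof (rule eq_matI)
  fix i j
  assume "i < dim_row B" "j < dim_col B"
  then have ij: "i < m" "j < n" using assms by auto
  then have "(A *\<^sub>v unit_vec n j) $ i = (B *\<^sub>v unit_vec n j) $ i"
    by (simp add: assms(3))
  with ij assms(1,2) show "A $$ (i, j) = B $$ (i, j)"
    by simp
qed (use assms in auto)

lemma mat_eqI_mult_vec:
  fixes A B :: "'a::semiring_1 mat"
  assumes "A \<in> carrier_mat m n" "B \<in> carrier_mat m n"
    and "\<And>w. w \<in> carrier_vec n \<Longrightarrow> A *\<^sub>v w = B *\<^sub>v w"
  shows "A = B"
  using assms(1,2) by (rule mat_eqI_unit_vec) (simp add: assms(3))

text \<open>This is \<open>I + a b\<^sup>T\<close>; shears, replacements of one column of
  \<open>I\<close>, and the projections below all have this form.\<close>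

definition rank_one_update :: "nat \<Rightarrow> 'a::field vec \<Rightarrow> 'a vec \<Rightarrow> 'a mat" where
  "rank_one_update r a b = mat r r (\<lambda>(i, j). (if i = j then 1 else 0) + a $ i * b $ j)"

lemma rank_one_update_carrier [simp]: "rank_one_update r a b \<in> carrier_mat r r"
  by (simp add: rank_one_update_def)

lemma rank_one_update_mult_vec:
  assumes [simp]: "a \<in> carrier_vec r" "b \<in> carrier_vec r" "w \<in> carrier_vec r"
  shows "rank_one_update r a b *\<^sub>v w = w + (b \<bullet> w) \<cdot>\<^sub>v a"
proof (rule eq_vecI)
  fix i
  assume "i < dim_vec (w + (b \<bullet> w) \<cdot>\<^sub>v a)"
  then have i: "i < r" using carrier_vecD[OF assms(1)] by simp
  then have "(rank_one_update r a b *\<^sub>v w) $ i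
    = (\<Sum>j = 0..<r. ((if i = j then 1 else 0) + a $ i * b $ j) * w $ j)"
    by (auto simp: rank_one_update_def scalar_prod_def carrier_vecD[OF assms(3)] intro!: sum.cong)
  also have "\<dots> = (\<Sum>j = 0..<r. if i = j then w $ j else 0) + (\<Sum>j = 0..<r. a $ i * (b $ j * w $ j))"
    unfolding sum.distrib[symmetric] by (intro sum.cong) (auto simp: algebra_simps)
  also have "\<dots> = w $ i + a $ i * (b \<bullet> w)"
    using i by (simp add: scalar_prod_def sum_distrib_left carrier_vecD[OF assms(3)])
  finally show "(rank_one_update r a b *\<^sub>v w) $ i = (w + (b \<bullet> w) \<cdot>\<^sub>v a) $ i"
    using i by (simp add: carrier_vecD[OF assms(1)] carrier_vecD[OF assms(3)])
qed (simp add: rank_one_update_def carrier_vecD[OF assms(1)])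

text \<open>The matrix \<open>I - u v\<^sup>T\<close>. If \<open>v \<bullet> u = 1\<close>, it is
  the projection along \<open>u\<close> onto the hyperplane orthogonal to \<open>v\<close>.\<close>

definition proj :: "nat \<Rightarrow> 'a::field vec \<Rightarrow> 'a vec \<Rightarrow> 'a mat" where
  "proj r u v = rank_one_update r (- u) v"

lemma proj_carrier [simp]: "proj r u v \<in> carrier_mat r r"
  by (simp add: proj_def)

lemma proj_mult_vec:
  assumes "u \<in> carrier_vec r" "v \<in> carrier_vec r" "w \<in> carrier_vec r"
  shows "proj r u v *\<^sub>v w = w - (v \<bullet> w) \<cdot>\<^sub>v u"
  using assms by (auto simp: proj_def rank_one_update_mult_vec intro!: eq_vecI)

text \<open>Exactly the idempotents with one-dimensional kernel: \<open>u\<close> spans the kernel,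
  and the image is orthogonal to \<open>v\<close>.\<close>

definition projs :: "nat \<Rightarrow> 'a::field mat set" where
  "projs r = {proj r u v | u v. u \<in> carrier_vec r \<and> v \<in> carrier_vec r \<and> v \<bullet> u = 1}"

lemma subsemigroup_gen_mono:
  assumes "A \<subseteq> subsemigroup_gen f B"
  shows "subsemigroup_gen f A \<subseteq> subsemigroup_gen f B"
proof
  fix x
  assume "x \<in> subsemigroup_gen f A"
  then show "x \<in> subsemigroup_gen f B"
    by induction (use assms in \<open>auto intro: subsemigroup_gen.mult\<close>)
qed

lemma subsemigroup_gen_mat_carrier:
  assumes "A \<subseteq> carrier_mat r r" "x \<in> subsemigroup_gen (*) A"
  shows "x \<in> carrier_mat r r"
  using assms(2) by induction (use assms(1) in auto)

lemma projs_carrier: "projs r \<subseteq> carrier_mat r r"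
  by (auto simp: projs_def)

lemma proj_mult:
  assumes [simp]: "u \<in> carrier_vec r" "v \<in> carrier_vec r" "x \<in> carrier_vec r" "y \<in> carrier_vec r"
    and w [simp]: "w \<in> carrier_vec r"
  shows "(proj r x y * proj r u v) *\<^sub>v w
    = w - (v \<bullet> w) \<cdot>\<^sub>v u - (y \<bullet> w - (v \<bullet> w) * (y \<bullet> u)) \<cdot>\<^sub>v x"
  by (simp add: assoc_mult_mat_vec[OF proj_carrier proj_carrier] proj_mult_vec
    scalar_prod_minus_distrib[of _ r] carrier_vecD[OF assms(1)] carrier_vecD[OF assms(4)])

text \<open>
  The product is \<open>I - u v\<^sup>T + a b'\<^sup>T\<close> with \<open>b' \<bullet> u = 0\<close>. If \<open>v \<bullet> a = 0\<close>, this is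
  \<open>(I - (u - a) v\<^sup>T) (I - u (v - b')\<^sup>T)\<close>; otherwise it is \<open>(I + a y\<^sup>T) (I - u v\<^sup>T)\<close> for the vector
  \<open>y = b' + t v\<close> with \<open>y \<bullet> a = - 1\<close>.
\<close>

lemma rank_one_update_mult_proj:
  fixes u :: "'a::field vec"
  assumes u: "u \<in> carrier_vec r" and v: "v \<in> carrier_vec r" and uv: "v \<bullet> u = 1"
    and a: "a \<in> carrier_vec r" and b: "b \<in> carrier_vec r"
  shows "rank_one_update r a b * proj r u v \<in> subsemigroup_gen (*) (projs r)"
proof -
  note [simp] = u v a b carrier_vecD[OF u] carrier_vecD[OF a]
  \<comment> \<open>Multiplying out, \<open>(I + a b\<^sup>T) (I - u v\<^sup>T) = I - u v\<^sup>T +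
    a (b - (b \<bullet> u) v)\<^sup>T\<close>.\<close>
  define b' where "b' = b - (b \<bullet> u) \<cdot>\<^sub>v v"
  have b' [simp]: "b' \<in> carrier_vec r"
    by (simp add: b'_def)
  have b'_dot: "b' \<bullet> w = b \<bullet> w - (b \<bullet> u) * (v \<bullet> w)" if "w \<in> carrier_vec r" for w
    using that by (simp add: b'_def minus_scalar_prod_distrib[of _ r])
  have b'u: "b' \<bullet> u = 0"
    using uv by (simp add: b'_dot)
  have lhs: "(rank_one_update r a b * proj r u v) *\<^sub>v w = w - (v \<bullet> w) \<cdot>\<^sub>v u + (b' \<bullet> w) \<cdot>\<^sub>v a"
    if [simp]: "w \<in> carrier_vec r" for w
    by (simp add: assoc_mult_mat_vec[OF rank_one_update_carrier proj_carrier] proj_mult_vec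
      rank_one_update_mult_vec b'_dot scalar_prod_minus_distrib[of _ r] mult.commute)
  have projsI: "proj r x y \<in> subsemigroup_gen (*) (projs r)"
    if "x \<in> carrier_vec r" "y \<in> carrier_vec r" "y \<bullet> x = 1" for x y :: "'a vec"
    using that by (intro subsemigroup_gen.gen) (auto simp: projs_def)
  show ?thesis
  proof (cases "v \<bullet> a = 0")
    case True
    have "rank_one_update r a b * proj r u v = proj r (u - a) v * proj r u (v - b')"
    proof (rule mat_eqI_mult_vec[of _ r r])
      fix w :: "'a vec"
      assume w [simp]: "w \<in> carrier_vec r"
      show "(rank_one_update r a b * proj r u v) *\<^sub>v w = (proj r (u - a) v * proj r u (v - b')) *\<^sub>v w"
        unfolding lhs[OF w] using carrier_vecD[OF w]
        by (subst proj_mult) (auto simp: minus_scalar_prod_distrib[of _ r] uv algebra_simps intro!: eq_vecI)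
    qed (meson mult_carrier_mat proj_carrier rank_one_update_carrier)+
    moreover have "proj r (u - a) v \<in> subsemigroup_gen (*) (projs r)"
      by (rule projsI) (simp_all add: scalar_prod_minus_distrib[of _ r] uv True)
    moreover have "proj r u (v - b') \<in> subsemigroup_gen (*) (projs r)"
      by (rule projsI) (simp_all add: minus_scalar_prod_distrib[of _ r] uv b'u)
    ultimately show ?thesis
      by (simp add: subsemigroup_gen.mult)
  next
    case False
    define t where "t = (- 1 - b' \<bullet> a) / (v \<bullet> a)"
    define y where "y = b' + t \<cdot>\<^sub>v v"
    have y [simp]: "y \<in> carrier_vec r"
      by (simp add: y_def)
    have y_dot: "y \<bullet> w = b' \<bullet> w + t * (v \<bullet> w)" if "w \<in> carrier_vec r" for w
      using that by (simp add: y_def add_scalar_prod_distrib[of _ r])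
    have yu: "y \<bullet> u = t"
      by (simp add: y_dot b'u uv)
    have ya: "y \<bullet> (- a) = 1"
      using False by (simp add: carrier_vecD[OF y] y_dot t_def)
    \<comment> \<open>\<open>b\<close> and \<open>y\<close> differ by a multiple of
      \<open>v\<close>, and \<open>v\<^sup>T (I - u v\<^sup>T) = 0\<close>, so both give the same
      product.\<close>
    have "rank_one_update r a b * proj r u v = proj r (- a) y * proj r u v"
    proof (rule mat_eqI_mult_vec[of _ r r])
      fix w :: "'a vec"
      assume w [simp]: "w \<in> carrier_vec r"
      show "(rank_one_update r a b * proj r u v) *\<^sub>v w = (proj r (- a) y * proj r u v) *\<^sub>v w"
        unfolding lhs[OF w] using carrier_vecD[OF w]
        by (subst proj_mult) (auto simp: y_dot yu b'u uv algebra_simps intro!: eq_vecI)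
    qed (meson mult_carrier_mat proj_carrier rank_one_update_carrier)+
    moreover have "proj r (- a) y \<in> subsemigroup_gen (*) (projs r)"
      by (rule projsI) (simp_all add: ya)
    ultimately show ?thesis
      using projsI[OF u v uv] by (simp add: subsemigroup_gen.mult)
  qed
qed

definition updates :: "nat \<Rightarrow> 'a::field mat set" where
  "updates r = {rank_one_update r a b | a b. a \<in> carrier_vec r \<and> b \<in> carrier_vec r}"

lemma updatesI: "a \<in> carrier_vec r \<Longrightarrow> b \<in> carrier_vec r \<Longrightarrow> rank_one_update r a b \<in> updates r"
  by (auto simp: updates_def)

lemma updates_carrier: "updates r \<subseteq> carrier_mat r r"
  by (auto simp: updates_def)

text \<open>The leftmost projection of a product absorbs \<open>T\<close>; the factors to its right
  stay as they are.\<close>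

lemma update_mult_projs_gen:
  assumes "B \<in> subsemigroup_gen (*) (projs r)" "T \<in> updates r"
  shows "T * B \<in> subsemigroup_gen (*) (projs r)"
  using assms(1)
proof induction
  case (gen B)
  then show ?case
    using assms(2) rank_one_update_mult_proj by (auto simp: updates_def projs_def)
next
  case (mult B C)
  then have "T * (B * C) = (T * B) * C"
    using subsemigroup_gen_mat_carrier[OF projs_carrier] updates_carrier assms(2)
    by (metis assoc_mult_mat subsetD)
  with mult show ?case
    by (simp add: subsemigroup_gen.mult)
qed

lemma updates_gen_mult_projs_gen:
  assumes "T \<in> subsemigroup_gen (*) (updates r)" "B \<in> subsemigroup_gen (*) (projs r)"
  shows "T * B \<in> subsemigroup_gen (*) (projs r)"
  using assms
proof (induction arbitrary: B)
  case (gen T)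
  then show ?case
    using update_mult_projs_gen by blast
next
  case (mult T U)
  then have "T * U * B = T * (U * B)"
    using subsemigroup_gen_mat_carrier[OF projs_carrier] subsemigroup_gen_mat_carrier[OF updates_carrier]
    by (metis assoc_mult_mat)
  with mult show ?case
    by simp
qed

text \<open>
  Gaussian elimination in the next two lemmas: every square matrix is a product of matrices
  \<open>I + a b\<^sup>T\<close>, by induction on the number \<open>k\<close> of initial columns that may differ from those of \<open>I\<close>.
\<close>

lemma updates_generate_pivot:
  fixes A :: "'a::field mat"
  assumes IH: "\<And>B :: 'a mat. B \<in> carrier_mat r r \<Longrightarrow> (\<And>l. k \<le> l \<Longrightarrow> l < r \<Longrightarrow> B *\<^sub>v unit_vec r l = unit_vec r l)
      \<Longrightarrow> B \<in> subsemigroup_gen (*) (updates r)"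
    and A: "A \<in> carrier_mat r r"
    and fixed: "\<And>l. k < l \<Longrightarrow> l < r \<Longrightarrow> A *\<^sub>v unit_vec r l = unit_vec r l"
    and k: "k < r" and pivot: "(A *\<^sub>v unit_vec r k) $ k \<noteq> 0"
  shows "A \<in> subsemigroup_gen (*) (updates r)"
proof -
  define c where "c = A *\<^sub>v unit_vec r k"
  have c: "c \<in> carrier_vec r"
    using A by (simp add: c_def)
  have ck: "c $ k \<noteq> 0"
    using pivot by (simp add: c_def)
  \<comment> \<open>\<open>T\<close> is \<open>I\<close> with column \<open>k\<close> replaced by
    \<open>c\<close>. For \<open>a = c - e\<^sub>k\<close> the inverse of
    \<open>I + a e\<^sub>k\<^sup>T\<close> is
    \<open>I - a e\<^sub>k\<^sup>T / (1 + a\<^sub>k)\<close>, and \<open>1 + a\<^sub>k\<close> is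
    the pivot \<open>c $ k\<close>.\<close>
  define T where "T = rank_one_update r (c - unit_vec r k) (unit_vec r k)"
  define T' where "T' = rank_one_update r ((- 1 / c $ k) \<cdot>\<^sub>v (c - unit_vec r k)) (unit_vec r k)"
  have T_carrier: "T \<in> carrier_mat r r" "T' \<in> carrier_mat r r"
    by (simp_all add: T_def T'_def)
  have T: "T *\<^sub>v w = w + (w $ k) \<cdot>\<^sub>v (c - unit_vec r k)" if "w \<in> carrier_vec r" for w
    unfolding T_def using that c k by (subst rank_one_update_mult_vec) auto
  have T': "T' *\<^sub>v w = w + (w $ k) \<cdot>\<^sub>v ((- 1 / c $ k) \<cdot>\<^sub>v (c - unit_vec r k))"
    if "w \<in> carrier_vec r" for w
    unfolding T'_def using that c k by (subst rank_one_update_mult_vec) auto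
  have inv: "T * T' = 1\<^sub>m r"
  proof (rule mat_eqI_mult_vec)
    fix w :: "'a vec"
    assume w: "w \<in> carrier_vec r"
    then have "T' *\<^sub>v w \<in> carrier_vec r"
      using T_carrier by simp
    with w show "T * T' *\<^sub>v w = 1\<^sub>m r *\<^sub>v w"
      using c k ck carrier_vecD[OF c] carrier_vecD[OF w]
      by (simp add: assoc_mult_mat_vec[OF T_carrier w] T)
        (auto simp: T' field_simps intro!: eq_vecI)
  qed (use T_carrier in auto)
  have TA: "T' * A \<in> carrier_mat r r"
    using A T_carrier by simp
  \<comment> \<open>\<open>T'\<close> sends \<open>c\<close> back to \<open>e\<^sub>k\<close> and
    fixes the later unit vectors, so the induction hypothesis will apply to
    \<open>T' * A\<close>.\<close>
  have "T' * A *\<^sub>v unit_vec r l = unit_vec r l" if l: "k \<le> l" "l < r" for l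
  proof -
    have "T' * A *\<^sub>v unit_vec r l = T' *\<^sub>v (A *\<^sub>v unit_vec r l)"
      by (rule assoc_mult_mat_vec[OF T_carrier(2) A]) simp
    also have "\<dots> = unit_vec r l"
    proof (cases "l = k")
      case True
      then have "T' *\<^sub>v (A *\<^sub>v unit_vec r l) = T' *\<^sub>v c"
        by (simp add: c_def)
      also have "\<dots> = unit_vec r l"
        using ck True carrier_vecD[OF c] by (auto simp: T'[OF c] intro!: eq_vecI)
      finally show ?thesis .
    next
      case False
      with l have "A *\<^sub>v unit_vec r l = unit_vec r l"
        by (intro fixed) auto
      then show ?thesis
        using l k False carrier_vecD[OF c] by (auto simp: T' intro!: eq_vecI)
    qed
    finally show ?thesis .
  qed
  then have "T' * A \<in> subsemigroup_gen (*) (updates r)"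
    using TA by (intro IH)
  moreover have "T \<in> subsemigroup_gen (*) (updates r)"
    using c by (intro subsemigroup_gen.gen) (auto simp: T_def intro!: updatesI)
  ultimately have "T * (T' * A) \<in> subsemigroup_gen (*) (updates r)"
    by (rule subsemigroup_gen.mult[rotated])
  moreover have "T * (T' * A) = A"
    using assoc_mult_mat[OF T_carrier A] inv A by simp
  ultimately show ?thesis
    by simp
qed

lemma updates_generate_fixing:
  fixes A :: "'a::field mat"
  assumes "A \<in> carrier_mat r r" "k \<le> r"
    and "\<And>l. k \<le> l \<Longrightarrow> l < r \<Longrightarrow> A *\<^sub>v unit_vec r l = unit_vec r l"
  shows "A \<in> subsemigroup_gen (*) (updates r)"
  using assms
proof (induction k arbitrary: A)
  case 0
  then have "A = rank_one_update r (0\<^sub>v r) (0\<^sub>v r)"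
    by (intro mat_eqI_unit_vec[of _ r r]) (auto simp: rank_one_update_mult_vec intro!: eq_vecI)
  then have "A \<in> updates r"
    by (simp add: updatesI)
  then show ?case
    by (rule subsemigroup_gen.gen)
next
  case (Suc k)
  note A = Suc.prems(1)
  have k: "k < r"
    using Suc.prems by simp
  have fixed: "A *\<^sub>v unit_vec r l = unit_vec r l" if "k < l" "l < r" for l
    using that by (intro Suc.prems) auto
  have pivot: "B \<in> subsemigroup_gen (*) (updates r)"
    if "B \<in> carrier_mat r r" "\<And>l. k < l \<Longrightarrow> l < r \<Longrightarrow> B *\<^sub>v unit_vec r l = unit_vec r l"
      "(B *\<^sub>v unit_vec r k) $ k \<noteq> 0" for B :: "'a mat"
  proof (rule updates_generate_pivot[OF _ that(1) that(2) k that(3)])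
    fix C :: "'a mat"
    assume "C \<in> carrier_mat r r" "\<And>l. k \<le> l \<Longrightarrow> l < r \<Longrightarrow> C *\<^sub>v unit_vec r l = unit_vec r l"
    then show "C \<in> subsemigroup_gen (*) (updates r)"
      using k by (intro Suc.IH) simp_all
  qed
  define c where "c = A *\<^sub>v unit_vec r k"
  have c: "c \<in> carrier_vec r"
    using A by (simp add: c_def)
  \<comment> \<open>If the pivot vanishes, a nonzero entry above it is added to it. If there is
    none, column \<open>k\<close> is a combination of later unit vectors and is split off by a
    factor on the right.\<close>
  consider "c $ k \<noteq> 0" | i where "i < k" "c $ i \<noteq> 0" "c $ k = 0" | "\<forall>i\<le>k. c $ i = 0"
    using le_neq_implies_less by blast
  then show ?case
  proof cases
    case 1
    then show ?thesis
      using A fixed by (intro pivot) (auto simp: c_def)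
  next
    case 2
    define T where "T = rank_one_update r (unit_vec r k) (- unit_vec r i :: 'a vec)"
    define T' where "T' = rank_one_update r (unit_vec r k) (unit_vec r i :: 'a vec)"
    have T_carrier: "T \<in> carrier_mat r r" "T' \<in> carrier_mat r r"
      by (simp_all add: T_def T'_def)
    have T: "T *\<^sub>v w = w - (w $ i) \<cdot>\<^sub>v unit_vec r k" if "w \<in> carrier_vec r" for w
      unfolding T_def using that 2 k by (subst rank_one_update_mult_vec) (auto intro!: eq_vecI)
    have T': "T' *\<^sub>v w = w + (w $ i) \<cdot>\<^sub>v unit_vec r k" if "w \<in> carrier_vec r" for w
      unfolding T'_def using that 2 k by (subst rank_one_update_mult_vec) auto
    have inv: "T * T' = 1\<^sub>m r"
    proof (rule mat_eqI_mult_vec)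
      fix w :: "'a vec"
      assume w: "w \<in> carrier_vec r"
      then have "T' *\<^sub>v w \<in> carrier_vec r"
        using T_carrier by simp
      with w show "T * T' *\<^sub>v w = 1\<^sub>m r *\<^sub>v w"
        using 2 k carrier_vecD[OF w]
        by (simp add: assoc_mult_mat_vec[OF T_carrier w] T)
          (auto simp: T' intro!: eq_vecI)
    qed (use T_carrier in auto)
    have T'A: "T' * A *\<^sub>v unit_vec r l = T' *\<^sub>v (A *\<^sub>v unit_vec r l)" for l
      by (rule assoc_mult_mat_vec[OF T_carrier(2) A]) simp
    have "T' * A *\<^sub>v unit_vec r l = unit_vec r l" if l: "k < l" "l < r" for l
      using 2 k l by (auto simp: T'A fixed T' intro!: eq_vecI)
    moreover have "(T' * A *\<^sub>v unit_vec r k) $ k \<noteq> 0"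
      using 2 k carrier_vecD[OF c]
      unfolding T'A c_def[symmetric] T'[OF c] by simp
    ultimately have "T' * A \<in> subsemigroup_gen (*) (updates r)"
      using A T_carrier by (intro pivot) auto
    moreover have "T \<in> subsemigroup_gen (*) (updates r)"
      by (intro subsemigroup_gen.gen) (auto simp: T_def intro!: updatesI)
    ultimately have "T * (T' * A) \<in> subsemigroup_gen (*) (updates r)"
      by (rule subsemigroup_gen.mult[rotated])
    moreover have "T * (T' * A) = A"
      using assoc_mult_mat[OF T_carrier A] inv A by simp
    ultimately show ?thesis
      by simp
  next
    case 3
    \<comment> \<open>\<open>B\<close> is \<open>A\<close> with column \<open>k\<close> replaced by
      that of \<open>I\<close>, and \<open>T\<close> is \<open>I\<close> with column
      \<open>k\<close> replaced by \<open>c\<close>. As \<open>c\<close> is supported on indices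
      beyond \<open>k\<close>, where the columns of \<open>B\<close> are those of \<open>I\<close>,
      \<open>B\<close> fixes \<open>c\<close>. Hence column \<open>k\<close> of \<open>B * T\<close>
      is \<open>c\<close> again.\<close>
    define B where "B = mat r r (\<lambda>(i, j). if j = k then unit_vec r k $ i else A $$ (i, j))"
    define T where "T = rank_one_update r (c - unit_vec r k) (unit_vec r k)"
    have carrier: "B \<in> carrier_mat r r" "T \<in> carrier_mat r r"
      by (simp_all add: T_def B_def)
    have T: "T *\<^sub>v w = w + (w $ k) \<cdot>\<^sub>v (c - unit_vec r k)" if "w \<in> carrier_vec r" for w
      unfolding T_def using that c k by (subst rank_one_update_mult_vec) auto
    have B_unit: "B *\<^sub>v unit_vec r l = (if l = k then unit_vec r k else A *\<^sub>v unit_vec r l)"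
      if "l < r" for l
      using that A by (auto simp: B_def intro!: eq_vecI)
    have Bc: "B *\<^sub>v c = c"
    proof (rule eq_vecI)
      fix i
      assume "i < dim_vec c"
      then have i: "i < r"
        using c by simp
      have "B $$ (i, j) * c $ j = (if i = j then c $ j else 0)" if j: "j < r" for j
      proof (cases "j \<le> k")
        case True
        with 3 show ?thesis by simp
      next
        case False
        with j have "(A *\<^sub>v unit_vec r j) $ i = unit_vec r j $ i"
          by (simp add: fixed)
        then show ?thesis
          using False i j A by (auto simp: B_def split: if_splits)
      qed
      then have "(\<Sum>j = 0..<r. B $$ (i, j) * c $ j) = (\<Sum>j = 0..<r. if i = j then c $ j else 0)"
        by (intro sum.cong) auto
      then show "(B *\<^sub>v c) $ i = c $ i"
        using i by (simp add: scalar_prod_def carrier_vecD[OF c] carrier_matD[OF carrier(1)])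
    qed (use carrier c in auto)
    have "A = B * T"
    proof (rule mat_eqI_unit_vec[OF A])
      fix l
      assume l: "l < r"
      have "B * T *\<^sub>v unit_vec r l = B *\<^sub>v (T *\<^sub>v unit_vec r l)"
        by (rule assoc_mult_mat_vec[OF carrier]) simp
      also have "T *\<^sub>v unit_vec r l = (if l = k then c else unit_vec r l)"
        using l k carrier_vecD[OF c] by (auto simp: T intro!: eq_vecI)
      finally show "A *\<^sub>v unit_vec r l = B * T *\<^sub>v unit_vec r l"
        using l by (auto simp: Bc[unfolded c_def] B_unit c_def)
    qed (use carrier in auto)
    moreover have "B \<in> subsemigroup_gen (*) (updates r)"
      using carrier k fixed by (intro Suc.IH) (auto simp: B_unit)
    moreover have "T \<in> subsemigroup_gen (*) (updates r)"
      using c by (intro subsemigroup_gen.gen) (auto simp: T_def intro!: updatesI)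
    ultimately show ?thesis
      by (simp add: subsemigroup_gen.mult)
  qed
qed

lemma ex_scalar_prod_eq_1:
  assumes u: "u \<in> carrier_vec r" and "u \<noteq> 0\<^sub>v r"
  shows "\<exists>v\<in>carrier_vec r. v \<bullet> u = (1 :: 'a::field)"
proof -
  obtain i where i: "i < r" "u $ i \<noteq> 0"
    using assms by (metis carrier_vecD eq_vecI index_zero_vec)
  have "((1 / u $ i) \<cdot>\<^sub>v unit_vec r i) \<bullet> u = 1"
    using i by (simp add: scalar_prod_smult_left carrier_vecD[OF u] scalar_prod_left_unit[OF u])
  then show ?thesis
    using i by (intro bexI[of _ "(1 / u $ i) \<cdot>\<^sub>v unit_vec r i"]) auto
qed

text \<open>A variant of a theorem of Erdos (1967), with all factors of corank one.\<close>

lemma singular_in_projs_gen: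
  fixes A :: "'a::field mat"
  assumes A: "A \<in> carrier_mat r r" and "det A = 0"
  shows "A \<in> subsemigroup_gen (*) (projs r)"
proof -
  obtain u where u: "u \<in> carrier_vec r" "u \<noteq> 0\<^sub>v r" "A *\<^sub>v u = 0\<^sub>v r"
    using assms det_0_iff_vec_prod_zero_field by blast
  then obtain v where v: "v \<in> carrier_vec r" "v \<bullet> u = 1"
    using ex_scalar_prod_eq_1 by blast
  \<comment> \<open>\<open>A\<close> kills \<open>u\<close>, so \<open>I - u v\<^sup>T\<close> may
    be appended on the right; this projection then absorbs the updates whose product is
    \<open>A\<close>.\<close>
  have "A = A * proj r u v"
  proof (rule mat_eqI_mult_vec[OF A])
    fix w :: "'a vec"
    assume w: "w \<in> carrier_vec r"
    have "A * proj r u v *\<^sub>v w = A *\<^sub>v (w - (v \<bullet> w) \<cdot>\<^sub>v u)"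
      by (simp add: assoc_mult_mat_vec[OF A proj_carrier w] proj_mult_vec u v w)
    also have "\<dots> = A *\<^sub>v w"
      using u w A by (auto simp: mult_minus_distrib_mat_vec[OF A] mult_mat_vec[OF A] intro!: eq_vecI)
    finally show "A *\<^sub>v w = A * proj r u v *\<^sub>v w" ..
  qed (rule mult_carrier_mat[OF A proj_carrier])
  moreover have "A \<in> subsemigroup_gen (*) (updates r)"
    by (rule updates_generate_fixing[OF A order_refl]) simp
  moreover have "proj r u v \<in> subsemigroup_gen (*) (projs r)"
    using u v by (intro subsemigroup_gen.gen) (auto simp: projs_def)
  ultimately show ?thesis
    using updates_gen_mult_projs_gen by metis
qed

subsection \<open>One idempotent for each line\<close>

lemma finite_carrier_mat:
  assumes "finite (UNIV :: 'a set)"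
  shows "finite (carrier_mat n m :: 'a mat set)"
proof (rule finite_subset)
  show "carrier_mat n m \<subseteq> mat n m ` (PiE ({..<n} \<times> {..<m}) (\<lambda>_. UNIV :: 'a set))"
  proof
    fix A :: "'a mat"
    assume "A \<in> carrier_mat n m"
    then have A: "A = mat n m (restrict (\<lambda>p. A $$ p) ({..<n} \<times> {..<m}))"
      by (intro eq_matI) auto
    show "A \<in> mat n m ` (PiE ({..<n} \<times> {..<m}) (\<lambda>_. UNIV))"
      by (subst A, rule imageI) (simp only: restrict_PiE_iff UNIV_I ball_triv simp_thms)
  qed
  show "finite (mat n m ` (PiE ({..<n} \<times> {..<m}) (\<lambda>_. UNIV :: 'a set)))"
    using assms by (intro finite_imageI finite_PiE) auto
qed

lemma pow_mat_mult_vec: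
  assumes "A \<in> carrier_mat r r" "w \<in> carrier_vec r"
  shows "(A ^\<^sub>m k) *\<^sub>v w = (((*\<^sub>v) A) ^^ k) w"
  using assms(2)
proof (induction k arbitrary: w)
  case 0
  then show ?case using assms(1) by simp
next
  case (Suc k)
  have "(A ^\<^sub>m Suc k) *\<^sub>v w = (A ^\<^sub>m k) *\<^sub>v (A *\<^sub>v w)"
    using assms(1) Suc.prems by (simp add: assoc_mult_mat_vec[OF pow_carrier_mat[OF assms(1)] assms(1)])
  also have "\<dots> = (((*\<^sub>v) A) ^^ k) (A *\<^sub>v w)"
    using assms(1) Suc.prems by (intro Suc.IH) simp
  finally show ?case
    by (simp add: funpow_swap1)
qed

lemma pow_mat_in_gen:
  assumes "A \<in> subsemigroup_gen (*) S" "A \<in> carrier_mat r r" "k > 0"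
  shows "A ^\<^sub>m k \<in> subsemigroup_gen (*) S"
  using assms(3)
proof (induction k rule: nat_induct_non_zero)
  case 1
  have "A ^\<^sub>m 1 = A"
    using assms(2) by simp
  with assms(1) show ?case by simp
next
  case (Suc k)
  then show ?case
    using assms(1) by (simp add: subsemigroup_gen.mult)
qed

text \<open>\<open>M\<close> maps into the hyperplane \<open>V\<close> orthogonal to
  \<open>v\<close>, and \<open>V\<close> meets the kernel, the line of \<open>u\<close>, only in
  zero. So \<open>M\<close> is injective on \<open>V\<close>, finiteness makes some power the
  identity on \<open>V\<close>, and this power still kills \<open>u\<close>.\<close>

lemma ex_pow_eq_proj:
  fixes M :: "'a::field mat"
  assumes fin: "finite (UNIV :: 'a set)"
    and M: "M \<in> carrier_mat r r" and u: "u \<in> carrier_vec r" and v: "v \<in> carrier_vec r"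
    and uv: "v \<bullet> u = 1" and Mu: "M *\<^sub>v u = 0\<^sub>v r"
    and vM: "\<And>w. w \<in> carrier_vec r \<Longrightarrow> v \<bullet> (M *\<^sub>v w) = 0"
    and ker: "\<And>w. w \<in> carrier_vec r \<Longrightarrow> M *\<^sub>v w = 0\<^sub>v r \<Longrightarrow> \<exists>a. w = a \<cdot>\<^sub>v u"
  shows "\<exists>k>0. M ^\<^sub>m k = proj r u v"
proof -
  define f where "f = (*\<^sub>v) M"
  define V where "V = {w \<in> carrier_vec r. v \<bullet> w = 0}"
  have f_V: "f w \<in> V" if "w \<in> carrier_vec r" for w
    using that M vM by (auto simp: f_def V_def)
  have "inj_on f V"
  proof (rule inj_onI)
    fix x y
    assume xy: "x \<in> V" "y \<in> V" "f x = f y"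
    then have "M *\<^sub>v (x - y) = 0\<^sub>v r"
      using M by (auto simp: mult_minus_distrib_mat_vec[OF M] V_def f_def intro!: eq_vecI)
    then obtain a where a: "x - y = a \<cdot>\<^sub>v u"
      using ker[of "x - y"] xy by (auto simp: V_def)
    have "v \<bullet> (x - y) = 0"
      using xy v by (simp add: V_def scalar_prod_minus_distrib[of _ r])
    then have "a = 0"
      using u v uv by (simp add: a)
    then have "x - y = 0\<^sub>v r"
      using a u by (auto intro!: eq_vecI)
    then have "(x - y) $ i = 0" if "i < r" for i
      using that by simp
    with xy show "x = y"
      by (auto simp: V_def intro!: eq_vecI)
  qed
  then have inj: "inj_on (f ^^ n) V" for n
  proof (induction n)
    case (Suc n)
    have "f ` V \<subseteq> V"
      using f_V by (auto simp: V_def)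
    then show ?case
      unfolding funpow_Suc_right using Suc by (intro comp_inj_on) (auto intro: inj_on_subset)
  qed simp
  have "\<not> inj (\<lambda>i. M ^\<^sub>m Suc i)"
  proof
    assume "inj (\<lambda>i. M ^\<^sub>m Suc i)"
    moreover have "range (\<lambda>i. M ^\<^sub>m Suc i) \<subseteq> carrier_mat r r"
      using M by auto
    ultimately show False
      using finite_carrier_mat[OF fin] by (meson finite_imageD finite_subset infinite_UNIV_nat)
  qed
  then obtain i j where "i < j" "M ^\<^sub>m Suc i = M ^\<^sub>m Suc j"
    unfolding inj_def by (metis linorder_neqE_nat)
  then obtain k where k: "k > 0" "M ^\<^sub>m Suc i = M ^\<^sub>m (Suc i + k)"
    by (metis add_Suc less_imp_add_positive)
  \<comment> \<open>The two equal powers of \<open>M\<close> agree on \<open>w\<close>; the common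
    power \<open>Suc i\<close> cancels because it is injective on \<open>V\<close>.\<close>
  have f_id: "(f ^^ k) w = w" if w: "w \<in> V" for w
  proof -
    have "(f ^^ k) w \<in> V"
      using w f_V by (induction k) (auto simp: V_def)
    moreover have "(f ^^ Suc i) ((f ^^ k) w) = (f ^^ Suc i) w"
      using k(2) w pow_mat_mult_vec[OF M, of w] unfolding f_def[symmetric]
      by (metis (mono_tags, lifting) V_def comp_apply funpow_add mem_Collect_eq)
    ultimately show ?thesis
      using inj[of "Suc i"] w by (meson inj_onD)
  qed
  have "M ^\<^sub>m k = proj r u v"
  proof (rule mat_eqI_mult_vec)
    fix w :: "'a vec"
    assume w: "w \<in> carrier_vec r"
    define w' where "w' = w - (v \<bullet> w) \<cdot>\<^sub>v u"
    have "w' \<in> V"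
      using w u v uv by (simp add: w'_def V_def scalar_prod_minus_distrib[of _ r])
    moreover have "f w = f w'"
      using w u M Mu by (auto simp: f_def w'_def mult_minus_distrib_mat_vec[OF M] mult_mat_vec[OF M] intro!: eq_vecI)
    \<comment> \<open>Here \<open>k > 0\<close> matters: the first application of \<open>f\<close>
      removes the multiple of \<open>u\<close>.\<close>
    then have "(f ^^ k) w = (f ^^ k) w'"
      using k(1) by (cases k) (simp_all add: funpow_Suc_right del: funpow.simps)
    ultimately show "(M ^\<^sub>m k) *\<^sub>v w = proj r u v *\<^sub>v w"
      using w u v f_id pow_mat_mult_vec[OF M w] by (simp add: proj_mult_vec w'_def f_def)
  qed (use M in auto)
  with k(1) show ?thesis by blast
qed

text \<open>The projection along \<open>x\<close> onto the hyperplane matched with \<open>x\<close>.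
  Dividing by \<open>dual x \<bullet> x\<close>, which is nonzero for points, normalizes the scalar
  product to \<open>1\<close>.\<close>

definition point_proj :: "nat \<Rightarrow> 'a::field vec \<Rightarrow> 'a mat" where
  "point_proj r x = proj r x ((1 / (dual x \<bullet> x)) \<cdot>\<^sub>v dual x)"

lemma point_proj_carrier [simp]: "point_proj r x \<in> carrier_mat r r"
  by (simp add: point_proj_def)

lemma point_proj_mult_vec:
  assumes "x \<in> points r" "w \<in> carrier_vec r"
  shows "point_proj r x *\<^sub>v w = w - ((dual x \<bullet> w) / (dual x \<bullet> x)) \<cdot>\<^sub>v x"
  using assms points_carrier[OF assms(1)] points_carrier[OF dual_points[OF assms(1)]]
  by (simp add: point_proj_def proj_mult_vec)

lemma dual_point_proj:
  assumes "x \<in> points r" "w \<in> carrier_vec r"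
  shows "dual x \<bullet> (point_proj r x *\<^sub>v w) = 0"
  using assms points_carrier[OF assms(1)] points_carrier[OF dual_points[OF assms(1)]]
    dual_nonorthogonal[OF assms(1)]
  by (simp add: point_proj_mult_vec scalar_prod_minus_distrib[of _ r])

lemma point_proj_self:
  assumes "x \<in> points r"
  shows "point_proj r x *\<^sub>v x = 0\<^sub>v r"
  using points_carrier[OF assms] dual_nonorthogonal[OF assms] assms
  by (auto simp: point_proj_mult_vec intro!: eq_vecI)

lemma point_proj_eq_multiple:
  assumes "x \<in> points r" "w \<in> carrier_vec r" and eq: "point_proj r x *\<^sub>v w = 0\<^sub>v r"
  shows "w = ((dual x \<bullet> w) / (dual x \<bullet> x)) \<cdot>\<^sub>v x"
proof (rule eq_vecI)
  note x = points_carrier[OF assms(1)]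
  fix i
  assume "i < dim_vec (((dual x \<bullet> w) / (dual x \<bullet> x)) \<cdot>\<^sub>v x)"
  then have i: "i < r"
    using x by simp
  have "(w - ((dual x \<bullet> w) / (dual x \<bullet> x)) \<cdot>\<^sub>v x) $ i = 0"
    using eq i by (simp add: point_proj_mult_vec[OF assms(1,2)])
  then show "w $ i = (((dual x \<bullet> w) / (dual x \<bullet> x)) \<cdot>\<^sub>v x) $ i"
    using i x by simp
qed (use assms points_carrier[OF assms(1)] in auto)

lemma point_proj_idempotent:
  assumes "x \<in> points r"
  shows "point_proj r x * point_proj r x = point_proj r x"
proof (rule mat_eqI_mult_vec[of _ r r])
  fix w :: "'a vec"
  assume w: "w \<in> carrier_vec r"
  then have "point_proj r x *\<^sub>v w \<in> carrier_vec r"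
    by (rule mult_mat_vec_carrier[OF point_proj_carrier])
  moreover have "y - 0 \<cdot>\<^sub>v x = y" if "y \<in> carrier_vec r" for y
    using that points_carrier[OF assms] by (auto intro!: eq_vecI)
  ultimately have "point_proj r x *\<^sub>v (point_proj r x *\<^sub>v w) = point_proj r x *\<^sub>v w"
    using w assms by (simp add: point_proj_mult_vec[of x r "point_proj r x *\<^sub>v w"] dual_point_proj)
  then show "point_proj r x * point_proj r x *\<^sub>v w = point_proj r x *\<^sub>v w"
    by (simp add: assoc_mult_mat_vec[OF point_proj_carrier point_proj_carrier w])
qed (meson mult_carrier_mat point_proj_carrier)+

text \<open>
  Fewer than half of the points lie on the hyperplane: \<open>y \<mapsto> y + p\<close> maps the points on it
  injectively to points off it, and misses \<open>p\<close>.
\<close>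

lemma card_hyperplane_less:
  fixes z p :: "'a::field vec"
  assumes fin: "finite (UNIV :: 'a set)"
    and z: "z \<in> carrier_vec r" and p: "p \<in> points r" and pz: "p \<bullet> z \<noteq> 0"
  shows "2 * card {y \<in> points r. y \<bullet> z = 0} < card (points r :: 'a vec set)"
proof -
  let ?H = "{y \<in> points r. y \<bullet> z = 0}"
  note pc = points_carrier[OF p]
  have Hc: "y \<in> carrier_vec r" if "y \<in> ?H" for y
    using that points_carrier by blast
  have "\<exists>x\<in>points r. \<exists>c. c \<noteq> 0 \<and> y + p = c \<cdot>\<^sub>v x" if y: "y \<in> ?H" for y
  proof (rule ex_point_multiple)
    have yc: "y \<in> carrier_vec r"
      using y points_carrier by blast
    then show "y + p \<in> carrier_vec r"
      using pc by simp
    have "(y + p) \<bullet> z = p \<bullet> z"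
      using y yc pc z by (simp add: add_scalar_prod_distrib[of _ r])
    with pz z show "y + p \<noteq> 0\<^sub>v r"
      by auto
  qed
  then have "\<forall>y\<in>?H. \<exists>x. x \<in> points r \<and> (\<exists>c. y + p = c \<cdot>\<^sub>v x)"
    by blast
  from bchoice[OF this] obtain f where f: "\<And>y. y \<in> ?H \<Longrightarrow> f y \<in> points r"
    and ex_c: "\<forall>y\<in>?H. \<exists>c. y + p = c \<cdot>\<^sub>v f y"
    by blast
  from bchoice[OF ex_c] obtain c where eq: "\<And>y. y \<in> ?H \<Longrightarrow> y + p = c y \<cdot>\<^sub>v f y"
    by blast
  \<comment> \<open>Pairing with \<open>z\<close> shows that \<open>f y\<close> is off the
    hyperplane and that it determines \<open>c y\<close>, hence also \<open>y\<close>.\<close>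
  have cf: "c y * (f y \<bullet> z) = p \<bullet> z" if y: "y \<in> ?H" for y
  proof -
    have "c y * (f y \<bullet> z) = (y + p) \<bullet> z"
      unfolding eq[OF y] using points_carrier[OF f[OF y]] z by simp
    also have "\<dots> = p \<bullet> z"
      using y pc z points_carrier[of y r] by (simp add: add_scalar_prod_distrib[of _ r])
    finally show ?thesis .
  qed
  have cancel: "y = y'" if "y + p = y' + p" "y \<in> carrier_vec r" "y' \<in> carrier_vec r" for y y'
  proof (rule eq_vecI)
    fix i
    assume "i < dim_vec y'"
    then have i: "i < r"
      using that by simp
    show "y $ i = y' $ i"
      using arg_cong[OF that(1), of "\<lambda>v. v $ i"] i that(2,3) pc by simp
  qed (simp add: carrier_vecD[OF that(2)] carrier_vecD[OF that(3)])
  have inj: "inj_on f ?H"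
  proof (rule inj_onI)
    fix y y'
    assume y: "y \<in> ?H" "y' \<in> ?H" and ff: "f y = f y'"
    have "c y * (f y' \<bullet> z) = c y' * (f y' \<bullet> z)" "f y' \<bullet> z \<noteq> 0"
      using cf[OF y(1)] cf[OF y(2)] pz ff by auto
    then have "c y = c y'"
      by simp
    then have "y + p = y' + p"
      using eq[OF y(1)] eq[OF y(2)] ff by simp
    then show "y = y'"
      by (rule cancel[OF _ Hc[OF y(1)] Hc[OF y(2)]])
  qed
  have "f y \<noteq> p" if y: "y \<in> ?H" for y
  proof
    assume fy: "f y = p"
    then have "c y = 1"
      using cf[OF y] pz by simp
    then have "y + p = 0\<^sub>v r + p"
      using eq[OF y] fy pc by simp
    then have "y = 0\<^sub>v r"
      by (rule cancel[OF _ Hc[OF y] zero_carrier_vec])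
    then show False
      using y points_nonzero by blast
  qed
  moreover have "f y \<bullet> z \<noteq> 0" if "y \<in> ?H" for y
    using cf[OF that] pz by auto
  ultimately have "insert p (f ` ?H) \<subseteq> points r - ?H" and p_notin: "p \<notin> f ` ?H"
    using f p pz by auto
  then have "card (insert p (f ` ?H)) \<le> card (points r - ?H)"
    using finite_points[OF fin] by (intro card_mono) auto
  also have "card (insert p (f ` ?H)) = Suc (card ?H)"
    using p_notin finite_points[OF fin, of r] inj by (simp add: card_image)
  also have "card (points r - ?H) = card (points r :: 'a vec set) - card ?H"
    using finite_points[OF fin, of r] by (intro card_Diff_subset) auto
  finally show ?thesis by simp
qed

text \<open>Each condition fails for fewer than half of the points, so some point satisfies both.
  For the first condition the bad points are counted through the injective map
  \<open>dual\<close>.\<close>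

lemma ex_connecting_point:
  fixes u z :: "'a::field vec"
  assumes fin: "finite (UNIV :: 'a set)" and u: "u \<in> points r" and z: "z \<in> points r"
  shows "\<exists>k\<in>points r. dual k \<bullet> z \<noteq> 0 \<and> dual u \<bullet> k \<noteq> 0"
proof (rule ccontr)
  assume none: "\<not> ?thesis"
  define H1 where "H1 = {k \<in> points r. dual k \<bullet> z = 0}"
  define H2 where "H2 = {k \<in> points r. k \<bullet> dual u = 0}"
  have comm: "dual u \<bullet> k = k \<bullet> dual u" if "k \<in> points r" for k
    using that u points_carrier dual_points by (metis comm_scalar_prod)
  have "dual ` H1 \<subseteq> {y \<in> points r. y \<bullet> z = 0}"
    using dual_points by (auto simp: H1_def)
  then have "card (dual ` H1) \<le> card {y \<in> points r. y \<bullet> z = 0}"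
    using finite_points[OF fin, of r] by (intro card_mono) auto
  moreover have "card (dual ` H1) = card H1"
    by (intro card_image inj_on_subset[OF inj_on_dual]) (auto simp: H1_def)
  ultimately have "2 * card H1 < card (points r :: 'a vec set)"
    using card_hyperplane_less[OF fin points_carrier[OF z] dual_points[OF z] dual_nonorthogonal[OF z]]
    by linarith
  moreover have "2 * card H2 < card (points r :: 'a vec set)"
    unfolding H2_def using dual_nonorthogonal[OF u] comm[OF u]
    by (intro card_hyperplane_less[OF fin points_carrier[OF dual_points[OF u]] u]) simp
  moreover have "card (points r :: 'a vec set) \<le> card (H1 \<union> H2)"
    using none comm finite_points[OF fin, of r] by (intro card_mono) (auto simp: H1_def H2_def)
  moreover have "card (H1 \<union> H2) \<le> card H1 + card H2"
    by (rule card_Un_le)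
  ultimately show False by linarith
qed

text \<open>Let \<open>u\<close> span the kernel and let the image be orthogonal to
  \<open>dual z\<close>. Between the matched projections of \<open>u\<close> and \<open>z\<close> a
  third one is put, such that no factor kills a nonzero vector in the image of the factor applied
  before it. Then the kernel of the product is still only the line of \<open>u\<close>.\<close>

lemma projs_subset_point_projs_gen:
  assumes fin: "finite (UNIV :: 'a::field set)"
  shows "projs r \<subseteq> subsemigroup_gen (*) (point_proj r ` points r :: 'a mat set)"
proof
  fix E :: "'a mat"
  assume "E \<in> projs r"
  then obtain u0 v0 where u0: "u0 \<in> carrier_vec r" and v0: "v0 \<in> carrier_vec r"
    and uv: "v0 \<bullet> u0 = 1" and E: "E = proj r u0 v0"
    by (auto simp: projs_def)
  have "u0 \<noteq> 0\<^sub>v r" "v0 \<noteq> 0\<^sub>v r"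
    using uv u0 v0 by auto
  then obtain u c y c' where u: "u \<in> points r" "c \<noteq> 0" "u0 = c \<cdot>\<^sub>v u"
    and y: "y \<in> points r" "c' \<noteq> 0" "v0 = c' \<cdot>\<^sub>v y"
    using ex_point_multiple u0 v0 by metis
  obtain z where z: "z \<in> points r" "y = dual z"
    using y(1) bij_betw_dual[OF fin, of r] by (auto simp: bij_betw_def)
  obtain k where k: "k \<in> points r" "dual k \<bullet> z \<noteq> 0" "dual u \<bullet> k \<noteq> 0"
    using ex_connecting_point[OF fin u(1) z(1)] by blast
  note car = points_carrier[OF u(1)] points_carrier[OF z(1)] points_carrier[OF k(1)]
    points_carrier[OF dual_points[OF u(1)]] points_carrier[OF dual_points[OF z(1)]]
    points_carrier[OF dual_points[OF k(1)]]
  note Pcar = mult_mat_vec_carrier[OF point_proj_carrier]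
  define M where "M = point_proj r z * (point_proj r k * point_proj r u)"
  have M_carrier: "M \<in> carrier_mat r r"
    unfolding M_def by (meson mult_carrier_mat point_proj_carrier)
  have M: "M *\<^sub>v w = point_proj r z *\<^sub>v (point_proj r k *\<^sub>v (point_proj r u *\<^sub>v w))"
    if w: "w \<in> carrier_vec r" for w
    unfolding M_def
    by (simp add: assoc_mult_mat_vec[OF point_proj_carrier mult_carrier_mat[OF point_proj_carrier point_proj_carrier] w]
      assoc_mult_mat_vec[OF point_proj_carrier point_proj_carrier w])
  have "\<exists>l>0. M ^\<^sub>m l = proj r u0 v0"
  proof (rule ex_pow_eq_proj[OF fin M_carrier u0 v0 uv])
    have "point_proj r x *\<^sub>v 0\<^sub>v r = 0\<^sub>v r" for x :: "'a vec"
      by (auto intro!: eq_vecI simp: carrier_matD[OF point_proj_carrier])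
    then have "M *\<^sub>v u = 0\<^sub>v r"
      by (simp add: M car point_proj_self[OF u(1)])
    then show "M *\<^sub>v u0 = 0\<^sub>v r"
      using u(3) car by (auto simp: mult_mat_vec[OF M_carrier] intro!: eq_vecI)
  next
    fix w :: "'a vec"
    assume w: "w \<in> carrier_vec r"
    then show "v0 \<bullet> (M *\<^sub>v w) = 0"
      using z y(3) car by (simp add: M Pcar dual_point_proj)
    assume "M *\<^sub>v w = 0\<^sub>v r"
    then have 1: "point_proj r z *\<^sub>v (point_proj r k *\<^sub>v (point_proj r u *\<^sub>v w)) = 0\<^sub>v r"
      using w by (simp add: M)
    have Pu: "point_proj r u *\<^sub>v w \<in> carrier_vec r"
      using w by (rule Pcar)
    have Pku: "point_proj r k *\<^sub>v (point_proj r u *\<^sub>v w) \<in> carrier_vec r"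
      using Pu by (rule Pcar)
    \<comment> \<open>A multiple of \<open>x\<close> that lies in the hyperplane of \<open>d\<close>
      vanishes, because \<open>x\<close> is off this hyperplane.\<close>
    have transfer: "s *\<^sub>v w' = 0\<^sub>v r" if "s *\<^sub>v w' = a \<cdot>\<^sub>v x" "d \<bullet> (s *\<^sub>v w') = 0" "d \<bullet> x \<noteq> 0"
      "d \<in> carrier_vec r" "x \<in> carrier_vec r" for s and w' d x :: "'a vec" and a
    proof -
      have "a = 0"
        using that by simp
      with that show ?thesis
        by (auto intro!: eq_vecI)
    qed
    have 2: "point_proj r k *\<^sub>v (point_proj r u *\<^sub>v w) = 0\<^sub>v r"
      by (rule transfer[OF point_proj_eq_multiple[OF z(1) Pku 1] dual_point_proj[OF k(1) Pu] k(2)]) (use car in auto)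
    have 3: "point_proj r u *\<^sub>v w = 0\<^sub>v r"
      by (rule transfer[OF point_proj_eq_multiple[OF k(1) Pu 2] dual_point_proj[OF u(1) w] k(3)]) (use car in auto)
    obtain a where "w = a \<cdot>\<^sub>v u"
      using point_proj_eq_multiple[OF u(1) w 3] by blast
    then have "w = (a / c) \<cdot>\<^sub>v u0"
      using u by (simp add: smult_smult_assoc)
    then show "\<exists>a. w = a \<cdot>\<^sub>v u0"
      by blast
  qed
  then obtain l where l: "l > 0" "M ^\<^sub>m l = E"
    unfolding E by blast
  have "M \<in> subsemigroup_gen (*) (point_proj r ` points r)"
    unfolding M_def using u(1) z(1) k(1) by (intro subsemigroup_gen.mult subsemigroup_gen.gen imageI)
  then show "E \<in> subsemigroup_gen (*) (point_proj r ` points r)"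
    using pow_mat_in_gen M_carrier l by metis
qed

lemma singular_in_point_projs_gen:
  fixes A :: "'a::field mat"
  assumes "finite (UNIV :: 'a set)" "A \<in> carrier_mat r r" "det A = 0"
  shows "A \<in> subsemigroup_gen (*) (point_proj r ` points r)"
  by (rule subsetD[OF subsemigroup_gen_mono[OF projs_subset_point_projs_gen[OF assms(1)]]
    singular_in_projs_gen[OF assms(2,3)]])

subsection \<open>The sandwich semigroup\<close>

text \<open>The \<open>\<iota>\<^sub>k\<close> of the overview; \<open>prj r k\<close> is its
  \<open>\<pi>\<^sub>k\<close>.\<close>

definition incl :: "nat \<Rightarrow> nat \<Rightarrow> 'a::field mat" where
  "incl k r = mat k r (\<lambda>(i, j). if i = j then 1 else 0)"

definition prj :: "nat \<Rightarrow> nat \<Rightarrow> 'a::field mat" where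
  "prj r k = mat r k (\<lambda>(i, j). if i = j then 1 else 0)"

lemma incl_dim [simp]: "dim_row (incl k r) = k" "dim_col (incl k r) = r"
  by (simp_all add: incl_def)

lemma prj_dim [simp]: "dim_row (prj r k) = r" "dim_col (prj r k) = k"
  by (simp_all add: prj_def)

lemma incl_carrier [simp]: "incl k r \<in> carrier_mat k r"
  by (simp add: incl_def)

lemma prj_carrier [simp]: "prj r k \<in> carrier_mat r k"
  by (simp add: prj_def)

text \<open>Conditions on dimensions alone make this usable as a rewrite rule, with right-nested
  products as normal form.\<close>

lemma mult_mat_assoc:
  fixes A B C :: "'a::semiring_0 mat"
  assumes "dim_col A = dim_row B" "dim_col B = dim_row C"
  shows "(A * B) * C = A * (B * C)"
  using assms by (intro assoc_mult_mat[of A "dim_row A" "dim_col A" B "dim_col B" C "dim_col C"]) auto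

lemma prj_mult_index:
  assumes "r \<le> k" "P \<in> carrier_mat k l" "i < r" "j < l"
  shows "(prj r k * P) $$ (i, j) = P $$ (i, j)"
proof -
  have "(prj r k * P) $$ (i, j) = (\<Sum>s = 0..<k. (if i = s then 1 else 0) * P $$ (s, j))"
    using assms by (simp add: prj_def scalar_prod_def)
  also have "\<dots> = (\<Sum>s = 0..<k. if i = s then P $$ (s, j) else 0)"
    by (intro sum.cong) auto
  finally show ?thesis
    using assms by simp
qed

lemma prj_mult_incl: "r \<le> k \<Longrightarrow> prj r k * incl k r = (1\<^sub>m r :: 'a::field mat)"
  by (rule eq_matI) (simp_all add: prj_mult_index[OF _ incl_carrier] del: index_mult_mat(1), simp_all add: incl_def)

lemma J_mat_factor:
  assumes "r \<le> n" "r \<le> m"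
  shows "J_mat n m r = incl n r * (prj r m :: 'a::field mat)"
proof (rule eq_matI)
  fix i j
  assume "i < dim_row (incl n r * (prj r m :: 'a mat))" "j < dim_col (incl n r * (prj r m :: 'a mat))"
  then have ij: "i < n" "j < m" by simp_all
  have "(incl n r * (prj r m :: 'a mat)) $$ (i, j)
    = (\<Sum>s = 0..<r. (if i = s then 1 else 0) * (if s = j then 1 else 0))"
    using ij by (simp add: prj_def incl_def scalar_prod_def)
  also have "\<dots> = (\<Sum>s = 0..<r. if i = s then (if s = j then 1 else 0) else 0)"
    by (intro sum.cong) auto
  finally have "(incl n r * (prj r m :: 'a mat)) $$ (i, j) = (if i < r \<and> i = j then 1 else 0)"
    by simp
  with ij assms show "(J_mat n m r :: 'a mat) $$ (i, j) = (incl n r * prj r m) $$ (i, j)"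
    by (auto simp: J_mat_def)
qed (use assms in \<open>auto simp: J_mat_def\<close>)

section \<open>Right inverses of \<open>\<pi>\<^sub>m\<close> and left inverses of
  \<open>\<iota>\<^sub>n\<close>\<close>

definition sections :: "nat \<Rightarrow> nat \<Rightarrow> 'a::field mat set" where
  "sections m r = {P \<in> carrier_mat m r. prj r m * P = 1\<^sub>m r}"

definition retractions :: "nat \<Rightarrow> nat \<Rightarrow> 'a::field mat set" where
  "retractions r n = {Q \<in> carrier_mat r n. Q * incl n r = 1\<^sub>m r}"

lemma sections_iff:
  assumes "r \<le> m"
  shows "P \<in> sections m r \<longleftrightarrow>
    P \<in> carrier_mat m r \<and> (\<forall>i<r. \<forall>j<r. P $$ (i, j) = (if i = j then 1 else 0))"
proof -
  have "prj r m * P = 1\<^sub>m r \<longleftrightarrow> (\<forall>i<r. \<forall>j<r. P $$ (i, j) = (if i = j then 1 else 0))"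
    if P: "P \<in> carrier_mat m r"
  proof
    assume eq: "prj r m * P = 1\<^sub>m r"
    show "\<forall>i<r. \<forall>j<r. P $$ (i, j) = (if i = j then 1 else 0)"
      using prj_mult_index[OF assms P] unfolding eq by simp
  next
    assume "\<forall>i<r. \<forall>j<r. P $$ (i, j) = (if i = j then 1 else 0)"
    then show "prj r m * P = 1\<^sub>m r"
      using P by (intro eq_matI) (simp_all add: prj_mult_index[OF assms P] del: index_mult_mat(1))
  qed
  then show ?thesis
    unfolding sections_def by blast
qed

text \<open>The top \<open>r\<close> rows are those of \<open>I\<close>; the other
  \<open>m - r\<close> rows are arbitrary.\<close>

lemma card_sections:
  assumes fin: "finite (UNIV :: 'a::field set)" and "r \<le> m"
  shows "card (sections m r :: 'a mat set) = card (UNIV :: 'a set) ^ (r * (m - r))"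
proof -
  define F where "F = PiE ({r..<m} \<times> {..<r}) (\<lambda>_. UNIV :: 'a set)"
  define h where "h f = mat m r (\<lambda>(i, j). if i < r then (if i = j then 1 else 0) else f (i, j) :: 'a)" for f
  have "bij_betw h F (sections m r)"
  proof (rule bij_betw_imageI)
    show "inj_on h F"
    proof (rule inj_onI)
      fix f g
      assume fg: "f \<in> F" "g \<in> F" "h f = h g"
      show "f = g"
      proof (rule PiE_ext[OF fg(1,2)[unfolded F_def]])
        fix p
        assume "p \<in> {r..<m} \<times> {..<r}"
        then obtain i j where p: "p = (i, j)" "r \<le> i" "i < m" "j < r"
          by auto
        have "h f $$ (i, j) = h g $$ (i, j)"
          by (simp only: fg(3))
        then show "f p = g p"
          using p by (simp add: h_def)
      qed
    qed
    show "h ` F = sections m r"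
    proof (intro equalityI subsetI)
      fix P
      assume "P \<in> h ` F"
      then show "P \<in> sections m r"
        using assms by (auto simp: sections_iff h_def)
    next
      fix P :: "'a mat"
      assume P: "P \<in> sections m r"
      then have eq: "P = h (restrict (\<lambda>p. P $$ p) ({r..<m} \<times> {..<r}))"
        using assms by (intro eq_matI) (auto simp: sections_iff h_def)
      show "P \<in> h ` F"
        unfolding F_def by (subst eq, rule imageI) (simp only: restrict_PiE_iff UNIV_I ball_triv simp_thms)
    qed
  qed
  then have "card (sections m r :: 'a mat set) = card F"
    by (simp add: bij_betw_same_card)
  also have "\<dots> = card (UNIV :: 'a set) ^ (r * (m - r))"
    unfolding F_def by (subst card_PiE) (simp_all add: mult.commute)
  finally show ?thesis .
qed

lemma transpose_incl: "(incl k r)\<^sup>T = (prj r k :: 'a::field mat)"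
  by (rule eq_matI) (auto simp: incl_def prj_def)

lemma transpose_prj: "(prj r k)\<^sup>T = (incl k r :: 'a::field mat)"
  by (rule eq_matI) (auto simp: incl_def prj_def)

lemma card_retractions:
  "card (retractions r n :: 'a::field mat set) = card (sections n r :: 'a mat set)"
proof -
  have "P\<^sup>T \<in> retractions r n" if "P \<in> sections n r" for P :: "'a mat"
    using that transpose_mult[OF prj_carrier, of P n r r]
    by (simp add: sections_def retractions_def transpose_prj)
  moreover have "Q\<^sup>T \<in> sections n r" if "Q \<in> retractions r n" for Q :: "'a mat"
    using that transpose_mult[of Q r n "incl n r" r]
    by (simp add: sections_def retractions_def transpose_incl)
  ultimately have "bij_betw transpose_mat (retractions r n) (sections n r :: 'a mat set)"
    by (intro bij_betw_byWitness[where f' = transpose_mat]) auto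
  then show ?thesis
    by (rule bij_betw_same_card)
qed

section \<open>The factored form of the elements\<close>

locale sandwich_semigroup =
  fixes m n r :: nat
  assumes r_le_m: "r \<le> m" and r_le_n: "r \<le> n"
begin

abbreviation star :: "'a::field mat \<Rightarrow> 'a mat \<Rightarrow> 'a mat" where
  "star \<equiv> sandwich (J_mat n m r)"

text \<open>The upper left block of size \<open>r\<close>. It turns the sandwich product into the
  ordinary matrix product, see \<open>core_sandwich\<close>.\<close>

definition core :: "'a::field mat \<Rightarrow> 'a mat" where
  "core X = prj r m * (X * incl n r)"

lemma core_carrier [simp]: "core X \<in> carrier_mat r r"
  by (rule carrier_matI) (simp_all add: core_def)

lemma core_dim [simp]: "dim_row (core X) = r" "dim_col (core X) = r"
  by (simp_all add: core_def)

lemma sandwich_eq: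
  fixes X Y :: "'a::field mat"
  assumes "X \<in> carrier_mat m n" "Y \<in> carrier_mat m n"
  shows "star X Y = X * incl n r * (prj r m * Y)"
  using assms by (simp add: sandwich_def J_mat_factor[OF r_le_n r_le_m] mult_mat_assoc)

lemma sandwich_mult_incl:
  assumes "X \<in> carrier_mat m n" "Y \<in> carrier_mat m n"
  shows "star X Y * incl n r = X * incl n r * core Y"
  using assms by (simp add: sandwich_eq mult_mat_assoc core_def)

lemma prj_mult_sandwich:
  assumes "X \<in> carrier_mat m n" "Y \<in> carrier_mat m n"
  shows "prj r m * star X Y = core X * (prj r m * Y)"
  using assms by (simp add: sandwich_eq mult_mat_assoc core_def)

lemma core_sandwich:
  assumes "X \<in> carrier_mat m n" "Y \<in> carrier_mat m n"
  shows "core (star X Y) = core X * core Y"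
  using assms by (simp add: sandwich_eq mult_mat_assoc core_def)

text \<open>The possible cores: an idempotent has an idempotent core, which is the identity if it is
  invertible, and products preserve this alternative.\<close>

definition one_or_singular :: "'a::field mat set" where
  "one_or_singular = {A \<in> carrier_mat r r. A = 1\<^sub>m r \<or> det A = 0}"

lemma one_or_singular_mult:
  "A \<in> one_or_singular \<Longrightarrow> B \<in> one_or_singular \<Longrightarrow> A * B \<in> one_or_singular"
  by (auto simp: one_or_singular_def det_mult[of _ r])

lemma one_or_singular_mult_eq_one:
  assumes "A \<in> one_or_singular" "B \<in> one_or_singular" "A * B = 1\<^sub>m r"
  shows "A = 1\<^sub>m r" "B = 1\<^sub>m r"
proof -
  have "det A * det B = 1"
    using assms det_mult[of A r B] by (simp add: one_or_singular_def)
  then have "det A \<noteq> 0" "det B \<noteq> 0"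
    by auto
  with assms show "A = 1\<^sub>m r" "B = 1\<^sub>m r"
    by (auto simp: one_or_singular_def)
qed

text \<open>For idempotent \<open>A\<close> the vector \<open>A w - w\<close> lies in the kernel,
  which is trivial if \<open>A\<close> is invertible.\<close>

lemma idempotent_one_or_singular:
  fixes A :: "'a::field mat"
  assumes A: "A \<in> carrier_mat r r" "A * A = A"
  shows "A \<in> one_or_singular"
proof (cases "det A = 0")
  case False
  have unit: "A *\<^sub>v w = w" if w: "w \<in> carrier_vec r" for w
  proof (rule ccontr)
    assume neq: "A *\<^sub>v w \<noteq> w"
    have "A *\<^sub>v (A *\<^sub>v w - w) = 0\<^sub>v r"
      using A w assoc_mult_mat_vec[OF A(1) A(1) w] by (auto simp: mult_minus_distrib_mat_vec[OF A(1)] intro!: eq_vecI)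
    moreover have "A *\<^sub>v w - w \<in> carrier_vec r"
      using A w by simp
    moreover have "A *\<^sub>v w - w \<noteq> 0\<^sub>v r"
    proof
      assume "A *\<^sub>v w - w = 0\<^sub>v r"
      then have "(A *\<^sub>v w - w) $ i = 0" if "i < r" for i
        using that by simp
      then have "A *\<^sub>v w = w"
        using A w by (intro eq_vecI) auto
      with neq show False ..
    qed
    ultimately show False
      using det_0_iff_vec_prod_zero_field[OF A(1)] False by blast
  qed
  have "A = 1\<^sub>m r"
    by (rule mat_eqI_mult_vec[OF A(1) one_carrier_mat]) (simp add: unit)
  then show ?thesis
    by (simp add: one_or_singular_def)
qed (use A in \<open>simp add: one_or_singular_def\<close>)

text \<open>For a finite field this is the whole generated semigroup, by
  \<open>E_semigroup_eq_factorizable\<close>. The bracketing is the normal form of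
  \<open>mult_mat_assoc\<close>.\<close>

definition factorizable :: "'a::field mat set" where
  "factorizable = {P * (A * Q) | P A Q. P \<in> sections m r \<and> A \<in> one_or_singular \<and> Q \<in> retractions r n}"

lemma factor_dims:
  "P \<in> sections m r \<Longrightarrow> dim_row P = m" "P \<in> sections m r \<Longrightarrow> dim_col P = r"
  "Q \<in> retractions r n \<Longrightarrow> dim_row Q = r" "Q \<in> retractions r n \<Longrightarrow> dim_col Q = n"
  "A \<in> one_or_singular \<Longrightarrow> dim_row A = r" "A \<in> one_or_singular \<Longrightarrow> dim_col A = r"
  by (auto simp: sections_def retractions_def one_or_singular_def)

lemma prj_section_cancel:
  assumes "P \<in> sections m r" "dim_row X = r"
  shows "prj r m * (P * X) = X"
proof -
  have "prj r m * (P * X) = prj r m * P * X"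
    using assms by (simp add: mult_mat_assoc factor_dims)
  also have "\<dots> = X"
    using assms left_mult_one_mat[of X r "dim_col X"] by (auto simp: sections_def)
  finally show ?thesis .
qed

lemma retraction_incl_cancel:
  assumes "Q \<in> retractions r n" "dim_row X = r"
  shows "Q * (incl n r * X) = X"
proof -
  have "Q * (incl n r * X) = Q * incl n r * X"
    using assms by (simp add: mult_mat_assoc factor_dims)
  also have "\<dots> = X"
    using assms left_mult_one_mat[of X r "dim_col X"] by (auto simp: retractions_def)
  finally show ?thesis .
qed

lemma retraction_incl: "Q \<in> retractions r n \<Longrightarrow> Q * incl n r = 1\<^sub>m r"
  by (simp add: retractions_def)

lemma incl_section [simp]: "incl m r \<in> sections m r"
  by (simp add: sections_def prj_mult_incl r_le_m)

lemma prj_retraction [simp]: "prj r n \<in> retractions r n"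
  by (simp add: retractions_def prj_mult_incl r_le_n)

lemma mult_one_dim [simp]:
  "dim_row X = r \<Longrightarrow> 1\<^sub>m r * X = X" "dim_col X = r \<Longrightarrow> X * 1\<^sub>m r = (X :: 'a::field mat)"
  using left_mult_one_mat[of X r "dim_col X"] right_mult_one_mat[of X "dim_row X" r] by auto

text \<open>\<open>Q J P' = (Q \<iota>\<^sub>n) (\<pi>\<^sub>m P') = I\<close>, so \<open>Q\<close>
  and \<open>P'\<close> disappear.\<close>

lemma sandwich_factored:
  fixes P A Q P' A' Q' :: "'a::field mat"
  assumes "P \<in> sections m r" "A \<in> carrier_mat r r" "Q \<in> retractions r n"
    and "P' \<in> sections m r" "A' \<in> carrier_mat r r" "Q' \<in> retractions r n"
  shows "star (P * (A * Q)) (P' * (A' * Q')) = P * (A * A' * Q')"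
proof -
  have "P * (A * Q) \<in> carrier_mat m n"
    by (rule carrier_matI) (simp_all add: factor_dims assms)
  moreover have "P' * (A' * Q') \<in> carrier_mat m n"
    by (rule carrier_matI) (simp_all add: factor_dims assms)
  ultimately show ?thesis
    using assms carrier_matD[OF assms(2)] carrier_matD[OF assms(5)]
    by (simp add: sandwich_eq mult_mat_assoc factor_dims prj_section_cancel retraction_incl_cancel)
qed

lemma core_factored:
  fixes P A Q :: "'a::field mat"
  assumes "P \<in> sections m r" "A \<in> carrier_mat r r" "Q \<in> retractions r n"
  shows "core (P * (A * Q)) = A" "P * (A * Q) * incl n r = P * A" "prj r m * (P * (A * Q)) = A * Q"
  using assms carrier_matD[OF assms(2)]
  by (simp_all add: core_def mult_mat_assoc factor_dims prj_section_cancel retraction_incl)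

lemma factorizable_carrier: "X \<in> factorizable \<Longrightarrow> X \<in> carrier_mat m n"
  unfolding factorizable_def by (auto intro!: carrier_matI simp: factor_dims)

lemma core_factorizable: "X \<in> factorizable \<Longrightarrow> core X \<in> one_or_singular"
  by (auto simp: factorizable_def one_or_singular_def core_factored)

lemma sandwich_factorizable:
  "X \<in> factorizable \<Longrightarrow> Y \<in> factorizable \<Longrightarrow> star X Y \<in> factorizable"
proof -
  assume "X \<in> factorizable" "Y \<in> factorizable"
  then obtain P A Q P' A' Q' where
    "P \<in> sections m r" "A \<in> one_or_singular" "Q \<in> retractions r n" "X = P * (A * Q)"
    "P' \<in> sections m r" "A' \<in> one_or_singular" "Q' \<in> retractions r n" "Y = P' * (A' * Q')"
    unfolding factorizable_def by blast
  moreover from this have "star X Y = P * (A * A' * Q')"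
    by (simp add: sandwich_factored one_or_singular_def)
  ultimately show ?thesis
    unfolding factorizable_def using one_or_singular_mult by blast
qed

text \<open>\<open>X = U V\<close> with \<open>U = U A\<close> and \<open>V = A V\<close> for the
  idempotent core \<open>A\<close>. In general \<open>U\<close> and \<open>V\<close> are not yet a
  section and a retraction; they are completed by means of \<open>I - A\<close>.\<close>

lemma idempotent_factorizable:
  fixes X :: "'a::field mat"
  assumes X: "X \<in> carrier_mat m n" and idem: "X = star X X"
  shows "X \<in> factorizable"
proof -
  note idem' = idem[symmetric]
  define A where "A = core X"
  define U where "U = X * incl n r"
  define V where "V = prj r m * X"
  have carrier: "A \<in> carrier_mat r r" "U \<in> carrier_mat m r" "V \<in> carrier_mat r n"
    using X by (auto simp: A_def U_def V_def)
  have AA: "A * A = A"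
    unfolding A_def by (rule core_sandwich[OF X X, unfolded idem', symmetric])
  have UA: "U * A = U"
    unfolding A_def U_def by (rule sandwich_mult_incl[OF X X, unfolded idem', symmetric])
  have AV: "A * V = V"
    unfolding A_def V_def by (rule prj_mult_sandwich[OF X X, unfolded idem', symmetric])
  have UV: "U * V = X"
    unfolding U_def V_def by (rule sandwich_eq[OF X X, unfolded idem', symmetric])
  have prjU: "prj r m * U = A"
    by (simp add: A_def U_def core_def)
  have Vincl: "V * incl n r = A"
    using X by (simp add: A_def V_def core_def mult_mat_assoc)
  define D where "D = 1\<^sub>m r - A"
  have D: "D \<in> carrier_mat r r"
    unfolding D_def using carrier(1) by (rule minus_carrier_mat)
  have DA: "D * A = 0\<^sub>m r r"
    unfolding D_def minus_mult_distrib_mat[OF one_carrier_mat carrier(1) carrier(1)]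
    using carrier(1) by (simp add: AA)
  have AD: "A * D = 0\<^sub>m r r"
    unfolding D_def mult_minus_distrib_mat[OF carrier(1) one_carrier_mat carrier(1)]
    using carrier(1) by (simp add: AA)
  have sum: "A + D = 1\<^sub>m r"
    unfolding D_def using carrier(1) by (intro eq_matI) auto
  \<comment> \<open>The summand with \<open>D\<close> completes \<open>\<pi>\<^sub>m U = A\<close>
    to \<open>I\<close> and vanishes in \<open>P * A\<close>, because \<open>D * A = 0\<close>;
    dually for \<open>Q\<close>.\<close>
  define P where "P = U + incl m r * D"
  define Q where "Q = V + D * prj r n"
  have "prj r m * P = prj r m * U + prj r m * (incl m r * D)"
    unfolding P_def using carrier D by (intro mult_add_distrib_mat[of _ r m _ r]) auto
  also have "\<dots> = 1\<^sub>m r"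
    using carrier_matD(1)[OF D] by (simp add: prjU prj_section_cancel[OF incl_section] sum)
  finally have P: "P \<in> sections m r"
    using carrier D by (auto simp: sections_def P_def)
  have "Q * incl n r = V * incl n r + D * prj r n * incl n r"
    unfolding Q_def using carrier D by (intro add_mult_distrib_mat[of _ r n _ _ r]) auto
  also have "\<dots> = 1\<^sub>m r"
    using D by (simp add: Vincl sum mult_mat_assoc prj_mult_incl[OF r_le_n])
  finally have Q: "Q \<in> retractions r n"
    using carrier D by (auto simp: retractions_def Q_def)
  have "P * A = U * A + incl m r * D * A"
    unfolding P_def using carrier D by (intro add_mult_distrib_mat[of _ m r _ _ r]) auto
  also have "\<dots> = U"
    using carrier D by (simp add: UA DA mult_mat_assoc)
  finally have PA: "P * A = U" .
  have "A * Q = A * V + A * (D * prj r n)"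
    unfolding Q_def using carrier D by (intro mult_add_distrib_mat[of _ r r _ n]) auto
  also have "A * (D * prj r n) = A * D * prj r n"
    using carrier D by (simp add: mult_mat_assoc)
  also have "A * V + \<dots> = V"
    using carrier D by (simp add: AV AD)
  finally have AQ: "A * Q = V" .
  have "P * (A * Q) = P * (A * (A * Q))"
    by (simp add: AQ AV)
  also have "\<dots> = (P * A) * (A * Q)"
    using carrier P Q by (simp add: mult_mat_assoc factor_dims)
  also have "\<dots> = X"
    by (simp add: PA AQ UV)
  finally have "X = P * (A * Q)" ..
  moreover have "A \<in> one_or_singular"
    using carrier(1) AA by (rule idempotent_one_or_singular)
  ultimately show ?thesis
    using P Q unfolding factorizable_def by blast
qed

lemma E_semigroup_subset: "E_semigroup m n r \<subseteq> (factorizable :: 'a::field mat set)"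
proof
  fix X :: "'a mat"
  assume "X \<in> E_semigroup m n r"
  then show "X \<in> factorizable"
    unfolding E_semigroup_def
  proof induction
    case (gen X)
    then show ?case
      unfolding idempotents_def by (blast intro: idempotent_factorizable)
  qed (rule sandwich_factorizable)
qed

end

text \<open>Surplus indices are sent to the first element. This lets two sets of different size be
  listed side by side.\<close>

lemma ex_image_lessThan_eq:
  assumes "finite S" "S \<noteq> {}" "card S \<le> N"
  shows "\<exists>f. f ` {..<N} = S"
proof -
  obtain h where h: "bij_betw h {0..<card S} S"
    using ex_bij_betw_nat_finite[OF assms(1)] by blast
  have "card S > 0"
    using assms by (simp add: card_gt_0_iff)
  have "(\<lambda>i. h (if i < card S then i else 0)) ` {..<N} = S"
  proof (intro equalityI subsetI)
    fix x
    assume "x \<in> (\<lambda>i. h (if i < card S then i else 0)) ` {..<N}"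
    then show "x \<in> S"
      using h \<open>card S > 0\<close> by (auto simp: bij_betw_def split: if_splits)
  next
    fix x
    assume "x \<in> S"
    then have "x \<in> h ` {0..<card S}"
      using h by (simp add: bij_betw_def)
    then obtain i where "i < card S" "x = h i"
      by auto
    then show "x \<in> (\<lambda>i. h (if i < card S then i else 0)) ` {..<N}"
      using assms(3) by (intro image_eqI[of _ _ i]) auto
  qed
  then show ?thesis by blast
qed

text \<open>The left kernel appears as the kernel of the transpose, since matrices act on column
  vectors. The equivalence demands the exact line of \<open>x\<close>, not mere containment.\<close>

definition left_kernel_line :: "nat \<Rightarrow> 'a::field mat \<Rightarrow> 'a vec \<Rightarrow> bool" where
  "left_kernel_line r A x \<longleftrightarrow>
    (\<forall>w\<in>carrier_vec r. A\<^sup>T *\<^sub>v w = 0\<^sub>v r \<longleftrightarrow> (\<exists>c. w = c \<cdot>\<^sub>v x))"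

text \<open>The transpose of any projection along \<open>x\<close> will do.\<close>

lemma ex_left_kernel_line:
  fixes x :: "'a::field vec"
  assumes x: "x \<in> points r"
  shows "\<exists>A\<in>carrier_mat r r. det A = 0 \<and> left_kernel_line r A x"
proof -
  note xc = points_carrier[OF x]
  obtain y where y: "y \<in> carrier_vec r" "y \<bullet> x = 1"
    using ex_scalar_prod_eq_1[OF xc points_nonzero[OF x]] by blast
  define A where "A = (proj r x y)\<^sup>T"
  have A: "A \<in> carrier_mat r r"
    by (simp add: A_def)
  have AT: "A\<^sup>T *\<^sub>v w = w - (y \<bullet> w) \<cdot>\<^sub>v x" if "w \<in> carrier_vec r" for w
    using that y xc by (simp add: A_def proj_mult_vec)
  have kernel: "left_kernel_line r A x"
    unfolding left_kernel_line_def
  proof (intro ballI iffI)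
    fix w :: "'a vec"
    assume w: "w \<in> carrier_vec r"
    {
      assume "A\<^sup>T *\<^sub>v w = 0\<^sub>v r"
      then have eq: "w - (y \<bullet> w) \<cdot>\<^sub>v x = 0\<^sub>v r"
        by (simp add: AT[OF w])
      have "w $ i = ((y \<bullet> w) \<cdot>\<^sub>v x) $ i" if "i < r" for i
        using arg_cong[OF eq, of "\<lambda>v. v $ i"] that w xc by simp
      then have "w = (y \<bullet> w) \<cdot>\<^sub>v x"
        using w xc by (intro eq_vecI) auto
      then show "\<exists>c. w = c \<cdot>\<^sub>v x" ..
    }
    assume "\<exists>c. w = c \<cdot>\<^sub>v x"
    then obtain c where c: "w = c \<cdot>\<^sub>v x" ..
    then have "y \<bullet> w = c"
      using y xc by simp
    then show "A\<^sup>T *\<^sub>v w = 0\<^sub>v r"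
      unfolding AT[OF w] using c xc by (auto intro!: eq_vecI)
  qed
  have "x = 1 \<cdot>\<^sub>v x"
    by simp
  then have "A\<^sup>T *\<^sub>v x = 0\<^sub>v r"
    using kernel xc unfolding left_kernel_line_def by blast
  then have "det (A\<^sup>T) = 0"
    using det_0_iff_vec_prod_zero_field[OF transpose_carrier_mat[THEN iffD2, OF A]] xc points_nonzero[OF x]
    by blast
  then have "det A = 0"
    by (simp add: det_transpose[OF A])
  with A kernel show ?thesis by blast
qed

text \<open>The left kernel of \<open>A\<close> lies in that of \<open>A * B\<close>, which is the
  line of \<open>x\<close>; being nonzero because \<open>det A = 0\<close>, it is the whole
  line.\<close>

lemma left_kernel_line_mult:
  fixes A B :: "'a::field mat"
  assumes A: "A \<in> carrier_mat r r" and B: "B \<in> carrier_mat r r" and x: "x \<in> carrier_vec r"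
    and kernel: "left_kernel_line r (A * B) x" and "det A = 0"
  shows "left_kernel_line r A x"
proof -
  note AT = transpose_carrier_mat[THEN iffD2, OF A]
  note BT = transpose_carrier_mat[THEN iffD2, OF B]
  have "det (A\<^sup>T) = 0"
    using det_transpose[OF A] \<open>det A = 0\<close> by simp
  then obtain v where v: "v \<in> carrier_vec r" "v \<noteq> 0\<^sub>v r" "A\<^sup>T *\<^sub>v v = 0\<^sub>v r"
    using det_0_iff_vec_prod_zero_field[OF AT] by blast
  have sub: "\<exists>c. w = c \<cdot>\<^sub>v x" if w: "w \<in> carrier_vec r" "A\<^sup>T *\<^sub>v w = 0\<^sub>v r" for w
  proof -
    have "(A * B)\<^sup>T *\<^sub>v w = B\<^sup>T *\<^sub>v (A\<^sup>T *\<^sub>v w)"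
      unfolding transpose_mult[OF A B] by (rule assoc_mult_mat_vec[OF BT AT w(1)])
    also have "\<dots> = 0\<^sub>v r"
      unfolding w(2) using B by (auto intro!: eq_vecI)
    finally show ?thesis
      using kernel w(1) unfolding left_kernel_line_def by blast
  qed
  obtain c where c: "v = c \<cdot>\<^sub>v x"
    using sub[OF v(1,3)] ..
  then have "c \<noteq> 0"
    using v(2) x by auto
  have "c \<cdot>\<^sub>v (A\<^sup>T *\<^sub>v x) = 0\<^sub>v r"
    using v(3) unfolding c by (simp add: mult_mat_vec[OF AT x])
  then have "(c \<cdot>\<^sub>v (A\<^sup>T *\<^sub>v x)) $ i = 0" if "i < r" for i
    using that by simp
  then have Ax: "A\<^sup>T *\<^sub>v x = 0\<^sub>v r"
    using \<open>c \<noteq> 0\<close> A x by (intro eq_vecI) auto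
  have "A\<^sup>T *\<^sub>v (d \<cdot>\<^sub>v x) = 0\<^sub>v r" for d
    unfolding mult_mat_vec[OF AT x] Ax by auto
  with sub show ?thesis
    unfolding left_kernel_line_def by blast
qed

section \<open>Upper bound: idempotent generators\<close>

context sandwich_semigroup
begin

definition point_idempotent :: "'a::field vec \<Rightarrow> 'a mat" where
  "point_idempotent x = incl m r * (point_proj r x * prj r n)"

lemma point_idempotent_carrier: "point_idempotent x \<in> carrier_mat m n"
  unfolding point_idempotent_def by (rule carrier_matI) simp_all

lemma point_idempotent_idem:
  assumes "x \<in> points r"
  shows "star (point_idempotent x) (point_idempotent x) = point_idempotent x"
  unfolding point_idempotent_def
  by (subst sandwich_factored) (simp_all add: point_proj_idempotent[OF assms])

text \<open>\<open>B \<mapsto> \<iota>\<^sub>m B \<pi>\<^sub>n\<close> is a homomorphism from matrix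
  multiplication to the sandwich product and carries the matched projections to the idempotents
  \<open>point_idempotent x\<close>.\<close>

lemma singular_in_gen:
  fixes A :: "'a::field mat"
  assumes fin: "finite (UNIV :: 'a set)" and A: "A \<in> carrier_mat r r" "det A = 0"
  shows "incl m r * (A * prj r n) \<in> subsemigroup_gen star (point_idempotent ` points r)"
proof -
  have "B \<in> carrier_mat r r \<and> incl m r * (B * prj r n) \<in> subsemigroup_gen star (point_idempotent ` points r)"
    if "B \<in> subsemigroup_gen (*) (point_proj r ` points r)" for B :: "'a mat"
    using that
  proof induction
    case (gen B)
    then obtain x where x: "x \<in> points r" "B = point_proj r x"
      by blast
    then have "incl m r * (B * prj r n) = point_idempotent x"
      by (simp add: point_idempotent_def)
    with x show ?case
      by (simp add: subsemigroup_gen.gen)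
  next
    case (mult B C)
    then have "star (incl m r * (B * prj r n)) (incl m r * (C * prj r n)) = incl m r * (B * C * prj r n)"
      by (simp add: sandwich_factored)
    with mult show ?case
      by (metis mult_carrier_mat subsemigroup_gen.mult)
  qed
  then show ?thesis
    using singular_in_point_projs_gen[OF fin A] by blast
qed

text \<open>The rectangular band law; with equal factors it shows that \<open>P * Q\<close> is
  idempotent.\<close>

lemma section_mult_retraction:
  fixes P Q P' Q' :: "'a::field mat"
  assumes "P \<in> sections m r" "Q \<in> retractions r n" "P' \<in> sections m r" "Q' \<in> retractions r n"
  shows "star (P * Q) (P' * Q') = P * Q'"
  using sandwich_factored[OF assms(1) one_carrier_mat assms(2,3) one_carrier_mat assms(4)] assms
  by (simp add: factor_dims)

text \<open>
  Listing sections and retractions side by side, with repetitions, gives products that generate the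
  whole rectangular band of the \<open>P * Q\<close>; the idempotents of corank one supply the rest.
\<close>

lemma ex_idempotent_generators:
  assumes fin: "finite (UNIV :: 'a::field set)"
    and N: "card (sections m r :: 'a mat set) \<le> N" "card (retractions r n :: 'a mat set) \<le> N"
  shows "\<exists>K \<subseteq> idempotents star (carrier_mat m n :: 'a mat set). finite K \<and>
    card K \<le> N + card (points r :: 'a vec set) \<and> factorizable \<subseteq> subsemigroup_gen star K"
proof -
  have "finite (sections m r :: 'a mat set)" "finite (retractions r n :: 'a mat set)"
    using finite_carrier_mat[OF fin] by (auto simp: sections_def retractions_def)
  moreover have "sections m r \<noteq> ({} :: 'a mat set)" "retractions r n \<noteq> ({} :: 'a mat set)"
    using incl_section prj_retraction by blast+
  ultimately obtain f g where f: "f ` {..<N} = (sections m r :: 'a mat set)"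
    and g: "g ` {..<N} = (retractions r n :: 'a mat set)"
    using ex_image_lessThan_eq N by metis
  define K where "K = (\<lambda>i. f i * g i) ` {..<N} \<union> point_idempotent ` points r"
  have fi: "f i \<in> sections m r" and gi: "g i \<in> retractions r n" if "i < N" for i
    using that f g by auto
  have "K \<subseteq> idempotents star (carrier_mat m n)"
  proof
    fix X
    assume "X \<in> K"
    then consider i where "i < N" "X = f i * g i" | x where "x \<in> points r" "X = point_idempotent x"
      unfolding K_def by blast
    then show "X \<in> idempotents star (carrier_mat m n)"
    proof cases
      case 1
      have "X \<in> carrier_mat m n"
        unfolding 1 using factor_dims(1)[OF fi[OF 1(1)]] factor_dims(4)[OF gi[OF 1(1)]]
        by (intro carrier_matI) simp_all
      moreover have "star X X = X"
        unfolding 1 by (intro section_mult_retraction fi gi 1(1))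
      ultimately show ?thesis
        by (simp add: idempotents_def)
    next
      case 2
      then show ?thesis
        by (simp add: idempotents_def point_idempotent_carrier point_idempotent_idem)
    qed
  qed
  moreover have "finite K"
    using finite_points[OF fin] by (simp add: K_def)
  moreover have "card K \<le> N + card (points r :: 'a vec set)"
    unfolding K_def
    by (rule order_trans[OF card_Un_le add_mono])
      (use card_image_le[of "{..<N}"] card_image_le[OF finite_points[OF fin]] in auto)
  moreover have "factorizable \<subseteq> subsemigroup_gen star K"
  proof
    have PQ: "P * Q \<in> subsemigroup_gen star K" if "P \<in> sections m r" "Q \<in> retractions r n" for P Q
    proof -
      have "P \<in> f ` {..<N}" "Q \<in> g ` {..<N}"
        using that by (simp_all add: f g)
      then obtain i j where ij: "i < N" "j < N" "P = f i" "Q = g j"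
        by blast
      then have "f i * g i \<in> K" "f j * g j \<in> K"
        by (auto simp: K_def)
      then have "star (f i * g i) (f j * g j) \<in> subsemigroup_gen star K"
        by (intro subsemigroup_gen.mult subsemigroup_gen.gen)
      also have "star (f i * g i) (f j * g j) = P * Q"
        unfolding ij by (intro section_mult_retraction fi gi ij(1,2))
      finally show ?thesis .
    qed
    fix X :: "'a mat"
    assume "X \<in> factorizable"
    then obtain P A Q where X: "X = P * (A * Q)" and P: "P \<in> sections m r"
      and A: "A \<in> one_or_singular" and Q: "Q \<in> retractions r n"
      unfolding factorizable_def by blast
    have carrier: "A \<in> carrier_mat r r"
      using A by (simp add: one_or_singular_def)
    show "X \<in> subsemigroup_gen star K"
    proof (cases "A = 1\<^sub>m r")
      case True
      then show ?thesis
        using PQ[OF P Q] Q by (simp add: X factor_dims)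
    next
      case False
      then have "det A = 0"
        using A by (simp add: one_or_singular_def)
      then have "incl m r * (A * prj r n) \<in> subsemigroup_gen star (point_idempotent ` points r)"
        by (rule singular_in_gen[OF fin carrier])
      moreover have "subsemigroup_gen star (point_idempotent ` points r) \<subseteq> subsemigroup_gen star K"
        by (rule subsemigroup_gen_mono) (auto simp: K_def intro: subsemigroup_gen.gen)
      ultimately have "incl m r * (A * prj r n) \<in> subsemigroup_gen star K"
        by blast
      \<comment> \<open>The band elements on both sides exchange the section
        \<open>\<iota>\<^sub>m\<close> for \<open>P\<close> and the retraction
        \<open>\<pi>\<^sub>n\<close> for \<open>Q\<close>.\<close>
      then have "star (P * prj r n) (star (incl m r * (A * prj r n)) (incl m r * Q)) \<in> subsemigroup_gen star K"
        using PQ[OF P prj_retraction] PQ[OF incl_section Q] by (intro subsemigroup_gen.mult)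
      also have "star (incl m r * (A * prj r n)) (incl m r * Q) = incl m r * (A * Q)"
        using sandwich_factored[OF incl_section carrier prj_retraction incl_section one_carrier_mat Q]
          Q carrier by (simp add: factor_dims)
      also have "star (P * prj r n) (incl m r * (A * Q)) = X"
        using sandwich_factored[OF P one_carrier_mat prj_retraction incl_section carrier Q]
          carrier P by (simp add: X factor_dims)
      finally show ?thesis .
    qed
  qed
  ultimately show ?thesis by blast
qed

section \<open>Lower bound: what every generating set must contain\<close>

context
  fixes G :: "'a::field mat set"
  assumes G: "G \<subseteq> factorizable"
begin

lemma gen_factorizable: "X \<in> subsemigroup_gen star G \<Longrightarrow> X \<in> factorizable"
proof (induction rule: subsemigroup_gen.induct)
  case (gen X)
  then show ?case using G by blast
qed (rule sandwich_factorizable)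

lemma gen_core: "X \<in> subsemigroup_gen star G \<Longrightarrow> core X \<in> one_or_singular"
  by (intro core_factorizable gen_factorizable)

lemma gen_carrier: "X \<in> subsemigroup_gen star G \<Longrightarrow> X \<in> carrier_mat m n"
  by (intro factorizable_carrier gen_factorizable)

text \<open>A product has core \<open>I\<close> only if all its factors do, and then its first
  factor determines \<open>X \<iota>\<^sub>n\<close>.\<close>

lemma ex_generator_same_column_part:
  "X \<in> subsemigroup_gen star G \<Longrightarrow> core X = 1\<^sub>m r \<Longrightarrow>
    \<exists>g\<in>G. core g = 1\<^sub>m r \<and> g * incl n r = X * incl n r"
proof (induction rule: subsemigroup_gen.induct)
  case (mult X Y)
  note car = gen_carrier[OF mult.hyps(1)] gen_carrier[OF mult.hyps(2)]
  have "core X * core Y = 1\<^sub>m r"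
    using mult.prems by (simp add: core_sandwich[OF car])
  then have one: "core X = 1\<^sub>m r" "core Y = 1\<^sub>m r"
    using one_or_singular_mult_eq_one gen_core mult.hyps by blast+
  then have "star X Y * incl n r = X * incl n r"
    by (simp add: sandwich_mult_incl[OF car])
  with mult.IH(1) one show ?case
    by simp
qed blast

text \<open>Dually, the last factor determines \<open>\<pi>\<^sub>m X\<close>.\<close>

lemma ex_generator_same_row_part:
  "X \<in> subsemigroup_gen star G \<Longrightarrow> core X = 1\<^sub>m r \<Longrightarrow>
    \<exists>g\<in>G. core g = 1\<^sub>m r \<and> prj r m * g = prj r m * X"
proof (induction rule: subsemigroup_gen.induct)
  case (mult X Y)
  note car = gen_carrier[OF mult.hyps(1)] gen_carrier[OF mult.hyps(2)]
  have "core X * core Y = 1\<^sub>m r"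
    using mult.prems by (simp add: core_sandwich[OF car])
  then have one: "core X = 1\<^sub>m r" "core Y = 1\<^sub>m r"
    using one_or_singular_mult_eq_one gen_core mult.hyps by blast+
  then have "prj r m * star X Y = prj r m * Y"
    by (simp add: prj_mult_sandwich[OF car])
  with mult.IH(2) one show ?case
    by simp
qed blast

lemma ex_generator_same_left_kernel:
  assumes x: "x \<in> carrier_vec r"
  shows "X \<in> subsemigroup_gen star G \<Longrightarrow> left_kernel_line r (core X) x \<Longrightarrow>
    \<exists>g\<in>G. left_kernel_line r (core g) x"
proof (induction rule: subsemigroup_gen.induct)
  case (mult X Y)
  note car = gen_carrier[OF mult.hyps(1)] gen_carrier[OF mult.hyps(2)]
  have kernel: "left_kernel_line r (core X * core Y) x"
    using mult.prems by (simp add: core_sandwich[OF car])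
  have "core X \<in> one_or_singular"
    using gen_core mult.hyps by blast
  then consider "core X = 1\<^sub>m r" | "det (core X) = 0"
    by (auto simp: one_or_singular_def)
  then show ?case
  proof cases
    case 1
    with kernel show ?thesis
      by (intro mult.IH(2)) simp
  next
    case 2
    then show ?thesis
      using left_kernel_line_mult[OF core_carrier core_carrier x kernel] by (intro mult.IH(1))
  qed
qed blast

text \<open>Generators with core \<open>I\<close> have to cover all sections and all retractions;
  the same generators may serve both, hence the maximum. Those with singular core come on top, at
  least one for each point.\<close>

lemma card_generators_ge:
  assumes fin: "finite (UNIV :: 'a set)" and "finite G"
    and generates: "factorizable \<subseteq> subsemigroup_gen star G"
  shows "max (card (sections m r :: 'a mat set)) (card (retractions r n :: 'a mat set))
    + card (points r :: 'a vec set) \<le> card G"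
proof -
  define G1 where "G1 = {g \<in> G. core g = 1\<^sub>m r}"
  define G2 where "G2 = {g \<in> G. det (core g) = 0}"
  have finG: "finite G1" "finite G2"
    using \<open>finite G\<close> by (auto simp: G1_def G2_def)
  have in_gen: "P * (A * Q) \<in> subsemigroup_gen star G"
    if "P \<in> sections m r" "A \<in> one_or_singular" "Q \<in> retractions r n" for P A Q
    using that generates unfolding factorizable_def by blast
  have one: "1\<^sub>m r \<in> one_or_singular"
    by (simp add: one_or_singular_def)
  have "sections m r \<subseteq> (\<lambda>g. g * incl n r) ` G1"
  proof
    fix P :: "'a mat"
    assume P: "P \<in> sections m r"
    obtain g where g: "g \<in> G" "core g = 1\<^sub>m r" "g * incl n r = P * (1\<^sub>m r * prj r n) * incl n r"
      using ex_generator_same_column_part[OF in_gen[OF P one prj_retraction]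
        core_factored(1)[OF P one_carrier_mat prj_retraction]] by blast
    then have "g * incl n r = P"
      using core_factored(2)[OF P one_carrier_mat prj_retraction] P by (simp add: factor_dims)
    with g show "P \<in> (\<lambda>g. g * incl n r) ` G1"
      unfolding G1_def by blast
  qed
  then have "card (sections m r :: 'a mat set) \<le> card G1"
    by (rule surj_card_le[OF finG(1)])
  moreover have "retractions r n \<subseteq> (\<lambda>g. prj r m * g) ` G1"
  proof
    fix Q :: "'a mat"
    assume Q: "Q \<in> retractions r n"
    obtain g where g: "g \<in> G" "core g = 1\<^sub>m r" "prj r m * g = prj r m * (incl m r * (1\<^sub>m r * Q))"
      using ex_generator_same_row_part[OF in_gen[OF incl_section one Q]
        core_factored(1)[OF incl_section one_carrier_mat Q]] by blast
    then have "prj r m * g = Q"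
      using core_factored(3)[OF incl_section one_carrier_mat Q] Q by (simp add: factor_dims)
    with g show "Q \<in> (\<lambda>g. prj r m * g) ` G1"
      unfolding G1_def by blast
  qed
  then have "card (retractions r n :: 'a mat set) \<le> card G1"
    by (rule surj_card_le[OF finG(1)])
  moreover have "\<exists>g. g \<in> G2 \<and> left_kernel_line r (core g) x" if x: "x \<in> points r" for x
  proof -
    note xc = points_carrier[OF x]
    obtain A where A: "A \<in> carrier_mat r r" "det A = 0" "left_kernel_line r A x"
      using ex_left_kernel_line[OF x] by blast
    then have "A \<in> one_or_singular"
      by (simp add: one_or_singular_def)
    then obtain g where g: "g \<in> G" "left_kernel_line r (core g) x"
      using ex_generator_same_left_kernel[OF xc in_gen[OF incl_section _ prj_retraction]]
        core_factored(1)[OF incl_section A(1) prj_retraction] A(3) by metis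
    \<comment> \<open>\<open>x\<close> itself is a nonzero vector of the left kernel, so the core of
      \<open>g\<close> is singular.\<close>
    have "x = 1 \<cdot>\<^sub>v x"
      by simp
    then have "(core g)\<^sup>T *\<^sub>v x = 0\<^sub>v r"
      using g(2) xc unfolding left_kernel_line_def by blast
    then have "det ((core g)\<^sup>T) = 0"
      using det_0_iff_vec_prod_zero_field[OF transpose_carrier_mat[THEN iffD2, OF core_carrier]]
        xc points_nonzero[OF x] by blast
    then have "det (core g) = 0"
      by (simp add: det_transpose[OF core_carrier])
    with g show ?thesis
      unfolding G2_def by blast
  qed
  then obtain h where h: "\<And>x. x \<in> points r \<Longrightarrow> h x \<in> G2 \<and> left_kernel_line r (core (h x)) x"
    by metis
  \<comment> \<open>A left kernel determines its line, and a line contains only one point.\<close>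
  have "inj_on h (points r)"
  proof (rule inj_onI)
    fix x y
    assume x: "x \<in> points r" and y: "y \<in> points r" and eq: "h x = h y"
    note kx = conjunct2[OF h[OF x], unfolded eq left_kernel_line_def, rule_format, OF points_carrier[OF x]]
    note ky = conjunct2[OF h[OF y], unfolded left_kernel_line_def, rule_format, OF points_carrier[OF x]]
    have "x = 1 \<cdot>\<^sub>v x"
      by simp
    then obtain c where "x = c \<cdot>\<^sub>v y"
      using kx ky by blast
    then show "x = y"
      using proportional_points_eq x y by blast
  qed
  then have "card (points r :: 'a vec set) \<le> card G2"
    using h finG(2) by (intro card_inj_on_le) auto
  \<comment> \<open>\<open>G1\<close> and \<open>G2\<close> are disjoint because
    \<open>det I = 1\<close>.\<close>
  moreover have "card G1 + card G2 = card (G1 \<union> G2)"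
    using finG by (intro card_Un_disjoint[symmetric]) (auto simp: G1_def G2_def)
  moreover have "card (G1 \<union> G2) \<le> card G"
    using \<open>finite G\<close> by (intro card_mono) (auto simp: G1_def G2_def)
  ultimately show ?thesis
    by linarith
qed

end

section \<open>The generated semigroup and its two ranks\<close>

lemma E_semigroup_eq_factorizable:
  assumes "finite (UNIV :: 'a::field set)"
  shows "E_semigroup m n r = (factorizable :: 'a mat set)"
proof
  obtain K where K: "K \<subseteq> idempotents star (carrier_mat m n :: 'a mat set)"
    "factorizable \<subseteq> subsemigroup_gen star K"
    using ex_idempotent_generators[OF assms max.cobounded1 max.cobounded2] by blast
  have "subsemigroup_gen star K \<subseteq> E_semigroup m n r"
    unfolding E_semigroup_def by (rule subsemigroup_gen_mono) (use K(1) in \<open>auto intro: subsemigroup_gen.gen\<close>)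
  with K(2) show "factorizable \<subseteq> (E_semigroup m n r :: 'a mat set)"
    by blast
qed (rule E_semigroup_subset)

end

theorem theorem7p5:
  fixes m n r q L :: nat
  assumes "finite (UNIV :: 'a::field set)"
    and "q = card (UNIV :: 'a set)"
    and "m \<ge> 1" and "n \<ge> 1"
    and "r \<le> min m n"
    and "r \<ge> 1"
    and "\<not> (r = m \<and> m = n)"
    and "L = max m n"
  shows "semigroup_rank (sandwich (J_mat n m r)) (E_semigroup m n r :: 'a mat set)
           = semigroup_idrank (sandwich (J_mat n m r)) (E_semigroup m n r :: 'a mat set)
         \<and> semigroup_idrank (sandwich (J_mat n m r)) (E_semigroup m n r :: 'a mat set)
           = enat (q ^ (r * (L - r)) + (q ^ r - 1) div (q - 1))"
proof -
  interpret sandwich_semigroup m n r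
    using assms by unfold_locales auto
  note fin = assms(1)
  let ?S = "E_semigroup m n r :: 'a mat set"
  define N where "N = max (card (sections m r :: 'a mat set)) (card (retractions r n :: 'a mat set))"
  define p where "p = card (points r :: 'a vec set)"
  have S: "?S = factorizable"
    by (rule E_semigroup_eq_factorizable[OF fin])
  have p: "p = (q ^ r - 1) div (q - 1)"
    by (simp add: p_def card_points[OF fin] assms(2))
  have "card {0 :: 'a} \<le> q"
    unfolding assms(2) by (rule card_mono[OF fin]) simp
  then have "q \<ge> 1"
    by simp
  \<comment> \<open>Monotonicity moves the maximum of the two counts into the exponent.\<close>
  then have "mono (\<lambda>k. q ^ k)"
    by (intro monoI power_increasing)
  then have "q ^ max (r * (m - r)) (r * (n - r)) = max (q ^ (r * (m - r))) (q ^ (r * (n - r)))"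
    by (rule max_of_mono[symmetric])
  also have "max (r * (m - r)) (r * (n - r)) = r * (L - r)"
    by (cases "m \<le> n") (simp_all add: assms(8) max_absorb1 max_absorb2 diff_le_mono)
  finally have N: "N = q ^ (r * (L - r))"
    unfolding N_def card_retractions card_sections[OF fin r_le_m] card_sections[OF fin r_le_n] assms(2) ..
  obtain K where K: "K \<subseteq> idempotents star (carrier_mat m n :: 'a mat set)" "finite K"
    "card K \<le> N + p" "factorizable \<subseteq> subsemigroup_gen star K"
    unfolding p_def N_def using ex_idempotent_generators[OF fin max.cobounded1 max.cobounded2] by blast
  have K_S: "K \<subseteq> ?S"
    unfolding E_semigroup_def using K(1) by (auto intro: subsemigroup_gen.gen)
  have "subsemigroup_gen star K \<subseteq> ?S"
    unfolding E_semigroup_def by (rule subsemigroup_gen_mono) (use K(1) in \<open>auto intro: subsemigroup_gen.gen\<close>)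
  then have "subsemigroup_gen star K = ?S"
    using K(4) S by blast
  moreover have "K \<subseteq> idempotents star ?S"
    using K(1) K_S unfolding idempotents_def by blast
  ultimately have "semigroup_idrank star ?S \<le> enat (card K)"
    unfolding semigroup_idrank_def using K(2) by (intro Inf_lower) blast
  also have "\<dots> \<le> enat (N + p)"
    using K(3) by simp
  finally have upper: "semigroup_idrank star ?S \<le> enat (N + p)" .
  \<comment> \<open>The idempotent generating sets are among all finite generating sets, so their
    infimum cannot be smaller.\<close>
  have le: "semigroup_rank star ?S \<le> semigroup_idrank star ?S"
    unfolding semigroup_rank_def semigroup_idrank_def
    by (rule Inf_superset_mono) (auto simp: idempotents_def)
  have lower: "enat (N + p) \<le> semigroup_rank star ?S"
    unfolding semigroup_rank_def
  proof (rule Inf_greatest)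
    fix e
    assume "e \<in> {enat (card A) | A. finite A \<and> A \<subseteq> ?S \<and> subsemigroup_gen star A = ?S}"
    then obtain A where A: "e = enat (card A)" "finite A" "A \<subseteq> ?S" "subsemigroup_gen star A = ?S"
      by blast
    then show "enat (N + p) \<le> e"
      using card_generators_ge[of A] fin S by (simp add: N_def p_def)
  qed
  show ?thesis
    using upper le lower unfolding N p by (metis order_antisym order_trans)
qed

end
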